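(* Let $n\geq 1$, let $\alpha\in\mathbf{R}$ and let $J=\begin{bmatrix}0&-I_n\\ I_n&0\end{bmatrix}\in M_{2n}(\mathbf{R})$. Suppose that $\Omega_1,\Omega_0,\Omega_{-1}$ are constant real symmetric $(2n)\times(2n)$ matrices such that $\Omega_1\geq 0$ and $-\Omega_{-1}\geq 0$ (positive semidefinite). Suppose further that the $\mathbf{R}^{2n}$-valued function $v$ satisfies the differential equation $$x\frac{dv}{dx}=J\bigl(\Omega_1x+\Omega_0+\alpha J+\Omega_{-1}x^{-1}\bigr)v,$$ and that $x^{\alpha}v(x)$ and $x^{\alpha-1}v(x)$ are bounded functions in $L^2((1,\infty);dx;\mathbf{R}^{2n})$. Then there exist a real linear subspace $K$ of $\mathbf{R}^{4n}$ with $\dim(K)\leq\operatorname{rank}(\Omega_1)+\operatorname{rank}(\Omega_{-1})$ and $\phi\in L^2((1,\infty);dx/x;K)$ such that the Hankel operator $\Gamma_\phi:L^2((1,\infty);dx/x)\to L^2((1,\infty);dx/x;K)$ is continuous and the integral operator $W$ on $L^2((1,\infty);dx/x)$ with kernel $$W(x,y)=\frac{(xy)^{(2\alpha+1)/2}}{x-y}\,\langle Jv(x),v(y)\rangle$$ factors as $$W=\Gamma_\phi^*\Gamma_\phi .$$ In particular, if $\operatorname{rank}(\Omega_1)+\operatorname{rank}(\Omega_{-1})=1$, then $W=\Gamma_\psi^2$ for some $\psi\in L^2((1,\infty);dx/x)$.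
   Context: $\langle\cdot,\cdot\rangle$ is the usual inner product on $\mathbf{R}^{2n}$, and $I_n$ is the $n\times n$ identity matrix. For a separable Hilbert space $K$, $L^2((1,\infty);dx/x;K)$ is the space of strongly measurable $\phi:(1,\infty)\to K$ with $\int_1^\infty\|\phi(x)\|_K^2\,dx/x<\infty$. On the interval $(1,\infty)$ the Hankel operator with symbol $\phi\in L^2((1,\infty);dx/x;K)$ is the multiplicative one, $\Gamma_\phi g(x)=\int_1^\infty\phi(xy)g(y)\,\frac{dy}{y}$, mapping scalar functions to $K$-valued functions; for scalar $\psi$ the operator $\Gamma_\psi$ is the case $K=\mathbf{R}$. The operator with kernel $W(x,y)$ is taken with respect to the measure $dy/y$: $Wg(x)=\int_1^\infty W(x,y)g(y)\,\frac{dy}{y}$ (the factor $\langle Jv(x),v(y)\rangle$ vanishes on the diagonal, so the kernel extends continuously to $x=y$). *)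

theory Defs
  imports "HOL-Analysis.Analysis"
begin

definition block_matrix ::
  "real^'n^'n \<Rightarrow> real^'n^'n \<Rightarrow> real^'n^'n \<Rightarrow> real^'n^'n \<Rightarrow> real^('n + 'n)^('n + 'n)" where
  "block_matrix A B C D = (\<chi> i j. case i of
      Inl a \<Rightarrow> (case j of Inl b \<Rightarrow> A $ a $ b | Inr b \<Rightarrow> B $ a $ b)
    | Inr a \<Rightarrow> (case j of Inl b \<Rightarrow> C $ a $ b | Inr b \<Rightarrow> D $ a $ b))"

definition J_mat :: "real^('n::finite + 'n)^('n + 'n)" where
  "J_mat = block_matrix 0 (- mat 1) (mat 1) 0"

definition pos_semidef :: "real^'m^'m \<Rightarrow> bool" where
  "pos_semidef A \<longleftrightarrow> (\<forall>u. 0 \<le> (A *v u) \<bullet> u)"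

text \<open>
  Elements of \<open>L\<^sup>2(M; K)\<close> are represented by functions. Functions that agree almost
  everywhere are not identified here; equations between elements of \<open>L\<^sup>2\<close> are stated
  almost everywhere instead. The set \<open>K\<close> of admissible values is meant to be a closed
  subspace of \<open>'b\<close>.
\<close>

definition l2 :: "'a measure \<Rightarrow> 'b::{real_inner, banach, second_countable_topology} set
    \<Rightarrow> ('a \<Rightarrow> 'b) set" where
  "l2 M K = {f \<in> borel_measurable M. (\<forall>x\<in>space M. f x \<in> K) \<and> integrable M (\<lambda>x. (norm (f x))\<^sup>2)}"

definition l2_inner ::
  "'a measure \<Rightarrow> ('a \<Rightarrow> 'b::{real_inner, banach, second_countable_topology}) \<Rightarrow> ('a \<Rightarrow> 'b) \<Rightarrow> real" where
  "l2_inner M f g = (LINT x|M. f x \<bullet> g x)"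

definition l2_norm ::
  "'a measure \<Rightarrow> ('a \<Rightarrow> 'b::{real_inner, banach, second_countable_topology}) \<Rightarrow> real" where
  "l2_norm M f = sqrt (l2_inner M f f)"

definition integral_op ::
  "'a measure \<Rightarrow> ('a \<Rightarrow> 'a \<Rightarrow> 'b::{real_inner, banach, second_countable_topology})
    \<Rightarrow> ('a \<Rightarrow> real) \<Rightarrow> 'a \<Rightarrow> 'b" where
  "integral_op M k g x = (LINT y|M. g y *\<^sub>R k x y)"

text \<open>
  The Bochner integral of a non-integrable function is \<open>0\<close> by convention, so convergence of
  the integrals defining the operator has to be required explicitly.
\<close>

definition maps_l2 ::
  "'a measure \<Rightarrow> 'b::{real_inner, banach, second_countable_topology} set
    \<Rightarrow> ('a \<Rightarrow> 'a \<Rightarrow> 'b) \<Rightarrow> bool" where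
  "maps_l2 M K k \<longleftrightarrow> (\<forall>g \<in> l2 M (UNIV :: real set).
     (AE x in M. integrable M (\<lambda>y. g y *\<^sub>R k x y)) \<and> integral_op M k g \<in> l2 M K)"

definition l2_continuous ::
  "'a measure \<Rightarrow> (('a \<Rightarrow> real) \<Rightarrow> 'a \<Rightarrow> 'b::{real_inner, banach, second_countable_topology})
    \<Rightarrow> bool" where
  "l2_continuous M T \<longleftrightarrow> (\<forall>f \<in> l2 M UNIV. \<forall>\<epsilon>>0. \<exists>\<delta>>0. \<forall>g \<in> l2 M UNIV.
     l2_norm M (\<lambda>x. g x - f x) < \<delta> \<longrightarrow> l2_norm M (\<lambda>x. T g x - T f x) < \<epsilon>)"

text \<open>\<open>S : L\<^sup>2(M; K) \<rightarrow> L\<^sup>2(M)\<close> is the Hilbert space adjoint of \<open>T : L\<^sup>2(M) \<rightarrow> L\<^sup>2(M; K)\<close>.\<close>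

definition is_l2_adjoint ::
  "'a measure \<Rightarrow> 'b::{real_inner, banach, second_countable_topology} set
    \<Rightarrow> (('a \<Rightarrow> real) \<Rightarrow> 'a \<Rightarrow> 'b) \<Rightarrow> (('a \<Rightarrow> 'b) \<Rightarrow> 'a \<Rightarrow> real) \<Rightarrow> bool" where
  "is_l2_adjoint M K T S \<longleftrightarrow> (\<forall>h \<in> l2 M K. S h \<in> l2 M UNIV \<and>
     (\<forall>g \<in> l2 M UNIV. l2_inner M (S h) g = l2_inner M h (T g)))"

definition l2_op_eq ::
  "'a measure \<Rightarrow> (('a \<Rightarrow> real) \<Rightarrow> 'a \<Rightarrow> real) \<Rightarrow> (('a \<Rightarrow> real) \<Rightarrow> 'a \<Rightarrow> real) \<Rightarrow> bool" where
  "l2_op_eq M S T \<longleftrightarrow> (\<forall>g \<in> l2 M UNIV. AE x in M. S g x = T g x)"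

definition dx_measure :: "real measure" where
  "dx_measure = restrict_space lborel {1<..}"

definition dx_over_x :: "real measure" where
  "dx_over_x = density dx_measure (\<lambda>x. ennreal (1 / x))"

definition hankel_kernel :: "(real \<Rightarrow> 'b) \<Rightarrow> real \<Rightarrow> real \<Rightarrow> 'b" where
  "hankel_kernel \<phi> x y = \<phi> (x * y)"

abbreviation hankel_op ::
  "(real \<Rightarrow> 'b::{real_inner, banach, second_countable_topology}) \<Rightarrow> (real \<Rightarrow> real) \<Rightarrow> real \<Rightarrow> 'b" where
  "hankel_op \<phi> \<equiv> integral_op dx_over_x (hankel_kernel \<phi>)"

text \<open>
  On the diagonal this kernel has the value \<open>0\<close> (division by zero) rather than its continuous
  extension. The diagonal section is a single point for each \<open>x\<close>, so the operator is unaffected.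
\<close>

definition W_kernel :: "real \<Rightarrow> (real \<Rightarrow> real^('n::finite + 'n)) \<Rightarrow> real \<Rightarrow> real \<Rightarrow> real" where
  "W_kernel \<alpha> v x y =
     (x * y) powr ((2 * \<alpha> + 1) / 2) / (x - y) * ((J_mat *v v x) \<bullet> v y)"

abbreviation W_op :: "real \<Rightarrow> (real \<Rightarrow> real^('n::finite + 'n)) \<Rightarrow> (real \<Rightarrow> real) \<Rightarrow> real \<Rightarrow> real" where
  "W_op \<alpha> v \<equiv> integral_op dx_over_x (W_kernel \<alpha> v)"

end

theory Submission
  imports Defs "HOL-Probability.Sinc_Integral"
begin

text \<open>
  Put \<open>u x = x powr \<alpha> *\<^sub>R v x\<close>. Since \<open>J\<^sup>2 = -1\<close>, the term \<open>\<alpha> J\<close> drops out of the equation for \<open>u\<close>, and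
  \<open>W(x, y) = sqrt (x y) \<langle>J u(x), u(y)\<rangle> / (x - y)\<close>. Differentiating along dilations and writing
  \<open>\<Omega>\<^sub>1\<close> and \<open>- \<Omega>\<^sub>-\<^sub>1\<close> as sums of squares of linear forms gives
  \<open>t d/dt W(t x, t y) = - \<langle>\<phi>(t x), \<phi>(t y)\<rangle>\<close>, where \<open>\<phi>\<close> has one component per linear form. As
  \<open>W(t x, t y)\<close> is integrable in \<open>t\<close>, it tends to \<open>0\<close>, so
  \<open>W(x, y) = \<integral>\<^sub>1\<^sup>\<infinity> \<langle>\<phi>(t x), \<phi>(t y)\<rangle> dt/t\<close>, which is the factorisation on the level of kernels.

  Square integrability of \<open>\<phi>\<close> alone does not make \<open>\<Gamma>\<^sub>\<phi>\<close> bounded. But \<open>\<parallel>\<Gamma>\<^sub>\<phi> g\<parallel>\<^sup>2 = \<langle>W g, g\<rangle>\<close> for \<open>g\<close>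
  supported in \<open>(1, n]\<close>, and the right-hand side is a Hilbert transform form composed with
  multiplication by the bounded function \<open>u\<close>. The regularised Hilbert form with kernel
  \<open>(x - y) / ((x - y)\<^sup>2 + \<epsilon>\<^sup>2)\<close> is bounded by \<open>\<pi>\<close> uniformly in \<open>\<epsilon>\<close>, because both it and the
  Poisson form are inner products of Fourier transforms in \<open>L\<^sup>2(e\<^sup>-\<^sup>\<epsilon>\<^sup>s ds)\<close>, and the Poisson form is
  bounded by Schur's test. The general case follows by truncation and Fatou's lemma.
\<close>

section \<open>Square-integrable functions\<close>

lemma l2_measurable [measurable_dest]: "f \<in> l2 M K \<Longrightarrow> f \<in> borel_measurable M"
  by (simp add: l2_def)

lemma l2_integrable_power2: "f \<in> l2 M K \<Longrightarrow> integrable M (\<lambda>x. (norm (f x))\<^sup>2)"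
  by (simp add: l2_def)

lemma l2_mono: "f \<in> l2 M K \<Longrightarrow> f \<in> l2 M UNIV"
  by (simp add: l2_def)

lemma l2_I:
  "f \<in> borel_measurable M \<Longrightarrow> integrable M (\<lambda>x. (norm (f x))\<^sup>2) \<Longrightarrow> f \<in> l2 M UNIV"
  by (simp add: l2_def)

lemma l2_norm_def': "l2_norm M f = sqrt (LINT x|M. (norm (f x))\<^sup>2)"
  by (simp add: l2_norm_def l2_inner_def power2_norm_eq_inner)

lemma l2_norm_power2: "(l2_norm M f)\<^sup>2 = (LINT x|M. (norm (f x))\<^sup>2)"
  by (simp add: l2_norm_def')

lemma l2_norm_nonneg [simp]: "0 \<le> l2_norm M f"
  by (simp add: l2_norm_def')

lemma l2_dominated:
  assumes "f \<in> borel_measurable M" "g \<in> l2 M K" "\<And>x. x \<in> space M \<Longrightarrow> norm (f x) \<le> norm (g x)"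
  shows "f \<in> l2 M UNIV" "l2_norm M f \<le> l2_norm M g"
proof -
  have *: "(norm (f x))\<^sup>2 \<le> (norm (g x))\<^sup>2" if "x \<in> space M" for x
    using assms(3)[OF that] by (simp add: power_mono)
  show f: "f \<in> l2 M UNIV"
    by (intro l2_I assms(1) Bochner_Integration.integrable_bound[OF l2_integrable_power2[OF assms(2)]])
      (use assms(1) * in auto)
  show "l2_norm M f \<le> l2_norm M g"
    unfolding l2_norm_def'
    by (intro real_sqrt_le_mono integral_mono l2_integrable_power2[OF f] l2_integrable_power2[OF assms(2)] *)
qed

lemma l2_integrable_mult_norm:
  assumes "f \<in> l2 M K" "g \<in> l2 M L"
  shows "integrable M (\<lambda>x. norm (f x) * norm (g x))"
proof (rule Bochner_Integration.integrable_bound)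
  show "integrable M (\<lambda>x. (norm (f x))\<^sup>2 + (norm (g x))\<^sup>2)"
    using assms by (simp add: l2_integrable_power2)
  have *: "norm (f x) * norm (g x) \<le> (norm (f x))\<^sup>2 + (norm (g x))\<^sup>2" for x
    using sum_squares_bound[of "norm (f x)" "norm (g x)"]
      mult_nonneg_nonneg[OF norm_ge_zero[of "f x"] norm_ge_zero[of "g x"]] by linarith
  then show "AE x in M. norm (norm (f x) * norm (g x)) \<le> norm ((norm (f x))\<^sup>2 + (norm (g x))\<^sup>2)"
    by simp
qed (use assms in measurable)

lemma l2_diff:
  assumes "f \<in> l2 M K" "g \<in> l2 M L"
  shows "(\<lambda>x. f x - g x) \<in> l2 M UNIV"
proof (rule l2_I)
  show "integrable M (\<lambda>x. (norm (f x - g x))\<^sup>2)"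
  proof (rule Bochner_Integration.integrable_bound)
    show "integrable M (\<lambda>x. 2 * (norm (f x))\<^sup>2 + 2 * (norm (g x))\<^sup>2)"
      using assms by (simp add: l2_integrable_power2)
    have *: "(norm (f x - g x))\<^sup>2 \<le> 2 * (norm (f x))\<^sup>2 + 2 * (norm (g x))\<^sup>2" for x
    proof -
      have "(norm (f x - g x))\<^sup>2 \<le> (norm (f x) + norm (g x))\<^sup>2"
        by (intro power_mono norm_triangle_ineq4) simp
      also have "\<dots> \<le> 2 * (norm (f x))\<^sup>2 + 2 * (norm (g x))\<^sup>2"
        using sum_squares_bound[of "norm (f x)" "norm (g x)"] by (simp add: power2_sum)
      finally show ?thesis .
    qed
    then show "AE x in M. norm ((norm (f x - g x))\<^sup>2) \<le> norm (2 * (norm (f x))\<^sup>2 + 2 * (norm (g x))\<^sup>2)"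
      by simp
  qed (use assms in measurable)
qed (use assms in measurable)

text \<open>The integral of \<open>(norm (f x) - s * norm (g x))\<^sup>2\<close> is nonnegative for
  every real \<open>s\<close>, and a quadratic polynomial in \<open>s\<close> without negative
  values satisfies the discriminant inequality \<open>R\<^sup>2 \<le> P * Q\<close>.\<close>

lemma l2_Cauchy_Schwarz:
  assumes f: "f \<in> l2 M K" and g: "g \<in> l2 M L"
  shows "(LINT x|M. norm (f x) * norm (g x)) \<le> l2_norm M f * l2_norm M g"
proof -
  define P Q R where "P = (LINT x|M. (norm (f x))\<^sup>2)" "Q = (LINT x|M. (norm (g x))\<^sup>2)"
    "R = (LINT x|M. norm (f x) * norm (g x))"
  note PQR = P_Q_R_def
  have quad: "0 \<le> P - 2 * s * R + s\<^sup>2 * Q" for s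
  proof -
    have "0 \<le> (LINT x|M. (norm (f x) - s * norm (g x))\<^sup>2)"
      by (intro integral_nonneg_AE) simp
    also have "\<dots> = (LINT x|M. (norm (f x))\<^sup>2 - (2 * s) * (norm (f x) * norm (g x)) + s\<^sup>2 * (norm (g x))\<^sup>2)"
      by (intro Bochner_Integration.integral_cong) (auto simp: power2_diff power_mult_distrib)
    also have "\<dots> = P - 2 * s * R + s\<^sup>2 * Q"
      using l2_integrable_mult_norm[OF f g] l2_integrable_power2[OF f] l2_integrable_power2[OF g]
      by (simp add: PQR)
    finally show ?thesis .
  qed
  have P0: "0 \<le> P" and Q0: "0 \<le> Q"
    by (auto simp: PQR intro!: integral_nonneg_AE)
  have "R\<^sup>2 \<le> P * Q"
  proof (cases "Q = 0")
    case True
    have "R = 0"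
    proof (rule ccontr)
      assume "R \<noteq> 0"
      \<comment> \<open>For \<open>Q = 0\<close> the polynomial is affine in \<open>s\<close>; this
        choice of \<open>s\<close> would give it the value \<open>-1\<close>.\<close>
      then have "2 * ((P + 1) / (2 * R)) * R = P + 1" by simp
      with quad[of "(P + 1) / (2 * R)"] True show False by simp
    qed
    then show ?thesis using True by simp
  next
    case False
    then have "0 \<le> P - R\<^sup>2 / Q"
      \<comment> \<open>\<open>R / Q\<close> is the minimiser of the polynomial.\<close>
      using quad[of "R / Q"] by (simp add: power2_eq_square field_simps)
    then show ?thesis using False Q0 by (simp add: field_simps)
  qed
  then have "R \<le> sqrt (P * Q)" by (rule real_le_rsqrt)
  then show ?thesis
    by (simp add: l2_norm_def' PQR real_sqrt_mult)
qed

lemma l2_inner_integrable: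
  assumes "f \<in> l2 M K" "g \<in> l2 M L"
  shows "integrable M (\<lambda>x. f x \<bullet> g x)"
  by (rule Bochner_Integration.integrable_bound[OF l2_integrable_mult_norm[OF assms]])
    (use assms in \<open>auto simp: Cauchy_Schwarz_ineq2\<close>)

lemma l2_inner_bound:
  assumes f: "f \<in> l2 M K" and g: "g \<in> l2 M L"
  shows "\<bar>LINT x|M. f x \<bullet> g x\<bar> \<le> l2_norm M f * l2_norm M g"
proof -
  have "norm (LINT x|M. f x \<bullet> g x) \<le> (LINT x|M. norm (f x) * norm (g x))"
    using l2_inner_integrable[OF f g] l2_integrable_mult_norm[OF f g]
    by (intro integral_norm_bound[THEN order_trans] integral_mono) (auto simp: Cauchy_Schwarz_ineq2)
  with l2_Cauchy_Schwarz[OF f g] show ?thesis by simp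
qed

lemma l2_scaleR_integrable:
  fixes g :: "'a \<Rightarrow> real"
  assumes g: "g \<in> l2 M K" and f: "f \<in> l2 M L"
  shows "integrable M (\<lambda>x. g x *\<^sub>R f x)"
  by (rule Bochner_Integration.integrable_bound[OF l2_integrable_mult_norm[OF g f]])
    (use assms in auto)

lemma l2_scaleR_bound:
  fixes g :: "'a \<Rightarrow> real"
  assumes g: "g \<in> l2 M K" and f: "f \<in> l2 M L"
  shows "norm (LINT x|M. g x *\<^sub>R f x) \<le> l2_norm M g * l2_norm M f"
proof -
  have "norm (LINT x|M. g x *\<^sub>R f x) \<le> (LINT x|M. norm (g x) * norm (f x))"
    using l2_scaleR_integrable[OF g f] l2_integrable_mult_norm[OF g f]
    by (intro integral_norm_bound[THEN order_trans] integral_mono) auto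
  with l2_Cauchy_Schwarz[OF g f] show ?thesis by simp
qed

text \<open>On \<open>E\<close> the norm of \<open>g x\<close> is at most
  \<open>1 + (norm (g x))\<^sup>2\<close>. The later uses of Fubini's theorem require
  \<open>g\<close> to be integrable, which square integrability alone does not give on a space of
  infinite measure; this is why they start from functions of finite support.\<close>

lemma l2_integrable_finite_support:
  assumes g: "g \<in> l2 M K" and E: "E \<in> sets M" "emeasure M E < \<infinity>" and supp: "\<And>x. x \<notin> E \<Longrightarrow> g x = 0"
  shows "integrable M g"
proof (rule Bochner_Integration.integrable_bound)
  show "integrable M (\<lambda>x. indicator E x + (norm (g x))\<^sup>2)"
    using l2_integrable_power2[OF g] E by (intro Bochner_Integration.integrable_add) auto
  have "norm (g x) \<le> norm (indicator E x + (norm (g x))\<^sup>2)" for x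
  proof (cases "x \<in> E")
    case True
    then show ?thesis
      using sum_squares_bound[of "norm (g x)" 1] by (simp add: abs_if)
  qed (simp add: supp)
  then show "AE x in M. norm (g x) \<le> norm (indicator E x + (norm (g x))\<^sup>2)" by simp
qed (use g in measurable)

lemma l2_dominated_tendsto:
  fixes g :: "'a \<Rightarrow> 'b::{real_inner, banach, second_countable_topology}"
  assumes g: "g \<in> l2 M K" and h: "\<And>n. h n \<in> borel_measurable M"
    and dom: "\<And>n x. x \<in> space M \<Longrightarrow> norm (h n x) \<le> norm (g x)"
    and lim: "\<And>x. x \<in> space M \<Longrightarrow> (\<lambda>n. h n x) \<longlonglongrightarrow> 0"
  shows "(\<lambda>n. l2_norm M (h n)) \<longlonglongrightarrow> 0"
proof -
  have "(\<lambda>n. LINT x|M. (norm (h n x))\<^sup>2) \<longlonglongrightarrow> (LINT x|M. 0)"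
  proof (rule integral_dominated_convergence)
    show "integrable M (\<lambda>x. (norm (g x))\<^sup>2)" by (rule l2_integrable_power2[OF g])
    show "AE x in M. (\<lambda>n. (norm (h n x))\<^sup>2) \<longlonglongrightarrow> 0"
      using tendsto_power[OF tendsto_norm_zero[OF lim], where n = 2] by simp
    show "AE x in M. norm ((norm (h n x))\<^sup>2) \<le> (norm (g x))\<^sup>2" for n
      using dom by (auto intro!: power_mono)
    show "(\<lambda>x. (norm (h n x))\<^sup>2) \<in> borel_measurable M" for n
      using h[of n] by measurable
  qed simp
  from tendsto_real_sqrt[OF this] show ?thesis
    by (simp add: l2_norm_def')
qed

text \<open>Fubini's theorem on \<open>(M \<Otimes>\<^sub>M M) \<Otimes>\<^sub>M N\<close>. Absolute
  integrability holds because the product of \<open>a\<close> and \<open>b\<close> is integrable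
  and, by Cauchy-Schwarz in \<open>t\<close>, the inner integral over \<open>N\<close> is at most
  \<open>A\<^sup>2\<close> uniformly in \<open>(x, y)\<close>. It serves twice: for the quadratic
  form of the Hankel operator and for inner products of Fourier transforms.\<close>

lemma Gram_form:
  fixes \<Phi> \<Psi> :: "'t \<Rightarrow> 'a \<Rightarrow> 'b::euclidean_space" and a b :: "'a \<Rightarrow> real"
  assumes N: "sigma_finite_measure N" and M: "sigma_finite_measure M"
    and meas [measurable]: "case_prod \<Phi> \<in> borel_measurable (N \<Otimes>\<^sub>M M)" "case_prod \<Psi> \<in> borel_measurable (N \<Otimes>\<^sub>M M)"
    and \<Phi>: "\<And>x. x \<in> space M \<Longrightarrow> (\<lambda>t. \<Phi> t x) \<in> l2 N UNIV" "\<And>x. x \<in> space M \<Longrightarrow> l2_norm N (\<lambda>t. \<Phi> t x) \<le> A"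
    and \<Psi>: "\<And>x. x \<in> space M \<Longrightarrow> (\<lambda>t. \<Psi> t x) \<in> l2 N UNIV" "\<And>x. x \<in> space M \<Longrightarrow> l2_norm N (\<lambda>t. \<Psi> t x) \<le> A"
    and a: "integrable M a" and b: "integrable M b"
    and \<Phi>a: "\<And>t. t \<in> space N \<Longrightarrow> integrable M (\<lambda>x. a x *\<^sub>R \<Phi> t x)"
    and \<Psi>b: "\<And>t. t \<in> space N \<Longrightarrow> integrable M (\<lambda>x. b x *\<^sub>R \<Psi> t x)"
  shows "integrable N (\<lambda>t. (LINT x|M. a x *\<^sub>R \<Phi> t x) \<bullet> (LINT y|M. b y *\<^sub>R \<Psi> t y))" (is ?th1)
    and "integrable (M \<Otimes>\<^sub>M M) (\<lambda>(x, y). a x * b y * (LINT t|N. \<Phi> t x \<bullet> \<Psi> t y))" (is ?th2)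
    and "(LINT t|N. (LINT x|M. a x *\<^sub>R \<Phi> t x) \<bullet> (LINT y|M. b y *\<^sub>R \<Psi> t y))
       = (LINT p|(M \<Otimes>\<^sub>M M). (case p of (x, y) \<Rightarrow> a x * b y * (LINT t|N. \<Phi> t x \<bullet> \<Psi> t y)))" (is ?th3)
proof -
  interpret N: sigma_finite_measure N by fact
  interpret M: sigma_finite_measure M by fact
  interpret MM: pair_sigma_finite M M ..
  interpret MMs: sigma_finite_measure "M \<Otimes>\<^sub>M M" by (rule MM.sigma_finite_measure_axioms)
  interpret P: pair_sigma_finite "M \<Otimes>\<^sub>M M" N ..
  have [measurable]: "a \<in> borel_measurable M" "b \<in> borel_measurable M" using a b by auto
  define G where "G = (\<lambda>p t. a (fst p) * b (snd p) * (\<Phi> t (fst p) \<bullet> \<Psi> t (snd p)))"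
  have [measurable]: "case_prod G \<in> borel_measurable ((M \<Otimes>\<^sub>M M) \<Otimes>\<^sub>M N)"
    unfolding G_def by measurable
  have ab: "integrable (M \<Otimes>\<^sub>M M) (\<lambda>p. a (fst p) * b (snd p))"
  proof (rule MM.Fubini_integrable)
    show "integrable M (\<lambda>x. LINT y|M. norm (a (fst (x, y)) * b (snd (x, y))))"
      using a by (simp add: abs_mult)
  qed (use b in auto)
  have bd: "(LINT t|N. norm (G p t)) \<le> \<bar>a (fst p) * b (snd p)\<bar> * A\<^sup>2" and iG: "integrable N (G p)"
    if p: "p \<in> space (M \<Otimes>\<^sub>M M)" for p
  proof -
    have p12: "fst p \<in> space M" "snd p \<in> space M" using p by (auto simp: space_pair_measure)
    note f = \<Phi>(1)[OF p12(1)] and g = \<Psi>(1)[OF p12(2)]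
    have i: "integrable N (\<lambda>t. \<Phi> t (fst p) \<bullet> \<Psi> t (snd p))" by (rule l2_inner_integrable[OF f g])
    show "integrable N (G p)" unfolding G_def using i by simp
    have "(LINT t|N. norm (G p t)) = \<bar>a (fst p) * b (snd p)\<bar> * (LINT t|N. \<bar>\<Phi> t (fst p) \<bullet> \<Psi> t (snd p)\<bar>)"
      by (simp add: G_def abs_mult)
    also have "(LINT t|N. \<bar>\<Phi> t (fst p) \<bullet> \<Psi> t (snd p)\<bar>) \<le> (LINT t|N. norm (\<Phi> t (fst p)) * norm (\<Psi> t (snd p)))"
      using i l2_integrable_mult_norm[OF f g] by (intro integral_mono) (auto simp: Cauchy_Schwarz_ineq2)
    also have "\<dots> \<le> l2_norm N (\<lambda>t. \<Phi> t (fst p)) * l2_norm N (\<lambda>t. \<Psi> t (snd p))"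
      by (rule l2_Cauchy_Schwarz[OF f g])
    also have "\<dots> \<le> A * A"
      using \<Phi>(2)[OF p12(1)] \<Psi>(2)[OF p12(2)] by (intro mult_mono) (auto intro: order_trans[OF l2_norm_nonneg])
    finally show "(LINT t|N. norm (G p t)) \<le> \<bar>a (fst p) * b (snd p)\<bar> * A\<^sup>2"
      by (simp add: power2_eq_square mult_left_mono)
  qed
  have int: "integrable ((M \<Otimes>\<^sub>M M) \<Otimes>\<^sub>M N) (case_prod G)"
  proof (rule P.Fubini_integrable)
    show "integrable (M \<Otimes>\<^sub>M M) (\<lambda>p. LINT t|N. norm (case_prod G (p, t)))"
    proof (rule Bochner_Integration.integrable_bound)
      show "integrable (M \<Otimes>\<^sub>M M) (\<lambda>p. \<bar>a (fst p) * b (snd p)\<bar> * A\<^sup>2)" using ab by simp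
      show "AE p in M \<Otimes>\<^sub>M M. norm (LINT t|N. norm (case_prod G (p, t))) \<le> norm (\<bar>a (fst p) * b (snd p)\<bar> * A\<^sup>2)"
      proof (rule AE_I2)
        fix p assume "p \<in> space (M \<Otimes>\<^sub>M M)"
        from bd[OF this] show "norm (LINT t|N. norm (case_prod G (p, t))) \<le> norm (\<bar>a (fst p) * b (snd p)\<bar> * A\<^sup>2)"
          by (simp add: integral_nonneg_AE)
      qed
    qed simp
    show "AE p in M \<Otimes>\<^sub>M M. integrable N (\<lambda>t. case_prod G (p, t))"
      using iG by auto
  qed simp
  have kap: "(LINT t|N. G p t) = (case p of (x, y) \<Rightarrow> a x * b y * (LINT t|N. \<Phi> t x \<bullet> \<Psi> t y))" for p
    by (simp add: G_def case_prod_beta)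
  have prod: "(LINT p|(M \<Otimes>\<^sub>M M). G p t) = (LINT x|M. a x *\<^sub>R \<Phi> t x) \<bullet> (LINT y|M. b y *\<^sub>R \<Psi> t y)"
    if t: "t \<in> space N" and i: "integrable (M \<Otimes>\<^sub>M M) (\<lambda>p. G p t)" for t
  proof -
    have "(LINT p|(M \<Otimes>\<^sub>M M). G p t) = (LINT x|M. LINT y|M. G (x, y) t)"
      by (rule MM.integral_fst'[OF i, symmetric])
    also have "\<dots> = (LINT x|M. LINT y|M. (a x *\<^sub>R \<Phi> t x) \<bullet> (b y *\<^sub>R \<Psi> t y))"
      by (simp add: G_def ac_simps)
    also have "\<dots> = (LINT x|M. (a x *\<^sub>R \<Phi> t x) \<bullet> (LINT y|M. b y *\<^sub>R \<Psi> t y))"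
      using \<Psi>b[OF t] by (intro Bochner_Integration.integral_cong refl integral_inner_right) auto
    also have "\<dots> = (LINT x|M. a x *\<^sub>R \<Phi> t x) \<bullet> (LINT y|M. b y *\<^sub>R \<Psi> t y)"
      using \<Phi>a[OF t] by (intro integral_inner_left) auto
    finally show ?thesis .
  qed
  \<comment> \<open>Integrability of \<open>G\<close> in the pair for fixed \<open>t\<close> is
    known for almost every \<open>t\<close> only, so the two sides are compared almost everywhere,
    with their measurability proved separately.\<close>
  have AEeq: "AE t in N. (LINT p|(M \<Otimes>\<^sub>M M). G p t) = (LINT x|M. a x *\<^sub>R \<Phi> t x) \<bullet> (LINT y|M. b y *\<^sub>R \<Psi> t y)"
    using P.AE_integrable_snd[OF int] AE_space by eventually_elim (rule prod)
  have m1: "(\<lambda>t. LINT p|(M \<Otimes>\<^sub>M M). G p t) \<in> borel_measurable N"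
    using P.integrable_snd[OF int] by auto
  have m2: "(\<lambda>t. (LINT x|M. a x *\<^sub>R \<Phi> t x) \<bullet> (LINT y|M. b y *\<^sub>R \<Psi> t y)) \<in> borel_measurable N"
    by (intro borel_measurable_inner M.borel_measurable_lebesgue_integral) measurable
  show ?th1
    using P.integrable_snd[OF int] integrable_cong_AE[OF m1 m2 AEeq] by simp
  show ?th2
    using P.integrable_fst[OF int] unfolding kap by simp
  have "(LINT t|N. (LINT x|M. a x *\<^sub>R \<Phi> t x) \<bullet> (LINT y|M. b y *\<^sub>R \<Psi> t y)) = (LINT t|N. LINT p|(M \<Otimes>\<^sub>M M). G p t)"
    using integral_cong_AE[OF m1 m2 AEeq] by simp
  also have "\<dots> = (LINT p|(M \<Otimes>\<^sub>M M). LINT t|N. G p t)"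
    by (rule P.Fubini_integral[OF int])
  finally show ?th3 unfolding kap .
qed

section \<open>Operators with a symmetric kernel\<close>

text \<open>
  The integral in \<open>form_bound\<close> is the quadratic form of \<open>T\<^sup>* T\<close>, so \<open>C\<close> bounds the norm of the operator
  \<open>T\<close> with kernel \<open>\<Phi>\<close>. It is only required for \<open>g\<close> supported in some \<open>E n\<close>, where Fubini's theorem
  applies.
\<close>

locale l2_kernel = sigma_finite_measure M for M :: "'a measure" +
  fixes \<Phi> :: "'a \<Rightarrow> 'a \<Rightarrow> 'b::euclidean_space" and E :: "nat \<Rightarrow> 'a set" and A C :: real
  assumes meas [measurable]: "case_prod \<Phi> \<in> borel_measurable (M \<Otimes>\<^sub>M M)"
    and sym: "\<And>x y. \<Phi> x y = \<Phi> y x"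
    and row: "\<And>x. x \<in> space M \<Longrightarrow> \<Phi> x \<in> l2 M UNIV"
    and row_bound: "\<And>x. x \<in> space M \<Longrightarrow> l2_norm M (\<Phi> x) \<le> A"
    and E_sets [measurable]: "\<And>n. E n \<in> sets M"
    and E_mono: "incseq E" and E_union: "(\<Union>n. E n) = space M"
    and E_finite: "\<And>n. emeasure M (E n) < \<infinity>"
    and C_nonneg: "0 \<le> C"
    and form_bound: "\<And>g n. g \<in> l2 M UNIV \<Longrightarrow> (\<And>x. x \<notin> E n \<Longrightarrow> g x = 0) \<Longrightarrow>
      integrable (M \<Otimes>\<^sub>M M) (\<lambda>(x, y). g x * g y * (LINT t|M. \<Phi> t x \<bullet> \<Phi> t y)) \<Longrightarrow>
      (LINT p|(M \<Otimes>\<^sub>M M). (case p of (x, y) \<Rightarrow> g x * g y * (LINT t|M. \<Phi> t x \<bullet> \<Phi> t y))) \<le> (C * l2_norm M g)\<^sup>2"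
begin

abbreviation T :: "('a \<Rightarrow> real) \<Rightarrow> 'a \<Rightarrow> 'b" where
  "T \<equiv> integral_op M \<Phi>"

text \<open>The transposed kernel would be \<open>\<Phi> t x\<close>. By \<open>sym\<close> it
  equals \<open>\<Phi> x t\<close>, so the bounds on the rows of \<Phi> control \<open>S\<close> as
  well as \<open>T\<close>.\<close>

definition S :: "('a \<Rightarrow> 'b) \<Rightarrow> 'a \<Rightarrow> real" where
  "S h x = (LINT t|M. \<Phi> x t \<bullet> h t)"

definition trunc :: "nat \<Rightarrow> ('a \<Rightarrow> 'c::real_vector) \<Rightarrow> 'a \<Rightarrow> 'c" where
  "trunc n g x = indicator (E n) x *\<^sub>R g x"

lemma T_integrable: "g \<in> l2 M UNIV \<Longrightarrow> x \<in> space M \<Longrightarrow> integrable M (\<lambda>y. g y *\<^sub>R \<Phi> x y)"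
  by (rule l2_scaleR_integrable[OF _ row])

lemma T_bound: "g \<in> l2 M UNIV \<Longrightarrow> x \<in> space M \<Longrightarrow> norm (T g x) \<le> l2_norm M g * A"
  unfolding integral_op_def
  by (rule order_trans[OF l2_scaleR_bound[OF _ row]]) (auto intro: mult_left_mono row_bound)

lemma T_diff:
  assumes "f \<in> l2 M UNIV" "g \<in> l2 M UNIV" "x \<in> space M"
  shows "T (\<lambda>x. f x - g x) x = T f x - T g x"
  unfolding integral_op_def using T_integrable[OF assms(1,3)] T_integrable[OF assms(2,3)]
  by (simp add: scaleR_diff_left)

lemma T_measurable [measurable]:
  assumes [measurable]: "g \<in> borel_measurable M"
  shows "T g \<in> borel_measurable M"
proof -
  have "(\<lambda>x. LINT y|M. g y *\<^sub>R \<Phi> x y) \<in> borel_measurable M"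
    by (rule borel_measurable_lebesgue_integral) measurable
  then show ?thesis by (simp add: integral_op_def[abs_def])
qed

lemma S_bound: "h \<in> l2 M UNIV \<Longrightarrow> x \<in> space M \<Longrightarrow> \<bar>S h x\<bar> \<le> A * l2_norm M h"
  unfolding S_def
  by (rule order_trans[OF l2_inner_bound[OF row]]) (auto intro: mult_right_mono row_bound)

lemma S_measurable [measurable]:
  assumes [measurable]: "h \<in> borel_measurable M"
  shows "S h \<in> borel_measurable M"
proof -
  have "(\<lambda>x. LINT t|M. \<Phi> x t \<bullet> h t) \<in> borel_measurable M"
    by (rule borel_measurable_lebesgue_integral) measurable
  then show ?thesis by (simp add: S_def[abs_def])
qed

section \<open>Truncation to the exhausting sets \<open>E n\<close>\<close>

lemma trunc_measurable [measurable]: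
  fixes g :: "'a \<Rightarrow> 'c::{real_inner, banach, second_countable_topology}"
  shows "g \<in> borel_measurable M \<Longrightarrow> trunc n g \<in> borel_measurable M"
  unfolding trunc_def[abs_def] by measurable

lemma trunc_l2:
  fixes g :: "'a \<Rightarrow> 'c::{real_inner, banach, second_countable_topology}"
  assumes g: "g \<in> l2 M K"
  shows "trunc n g \<in> l2 M UNIV"
proof -
  have [measurable]: "g \<in> borel_measurable M" using g by (rule l2_measurable)
  show ?thesis
    by (rule l2_dominated(1)[OF _ g]) (auto simp: trunc_def indicator_def)
qed

lemma trunc_outside: "x \<notin> E n \<Longrightarrow> trunc n g x = 0"
  by (simp add: trunc_def)

lemma trunc_eventually: "x \<in> space M \<Longrightarrow> \<forall>\<^sub>F n in sequentially. trunc n g x = g x"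
proof -
  assume "x \<in> space M"
  then obtain m where m: "x \<in> E m" using E_union by auto
  have "trunc n g x = g x" if "m \<le> n" for n
    using incseqD[OF E_mono that] m by (auto simp: trunc_def)
  then show ?thesis unfolding eventually_sequentially by blast
qed

lemma trunc_tendsto:
  fixes g :: "'a \<Rightarrow> 'c::{real_inner, banach, second_countable_topology}"
  assumes g: "g \<in> l2 M K"
  shows "(\<lambda>n. l2_norm M (\<lambda>x. g x - trunc n g x)) \<longlonglongrightarrow> 0"
proof (rule l2_dominated_tendsto[OF g])
  have [measurable]: "g \<in> borel_measurable M" using g by (rule l2_measurable)
  show "(\<lambda>x. g x - trunc n g x) \<in> borel_measurable M" for n by measurable
  show "norm (g x - trunc n g x) \<le> norm (g x)" for n x
    by (simp add: trunc_def indicator_def)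
  show "(\<lambda>n. g x - trunc n g x) \<longlonglongrightarrow> 0" if "x \<in> space M" for x
    by (rule tendsto_eventually) (use trunc_eventually[OF that, of g] in \<open>auto elim: eventually_mono\<close>)
qed

lemma supported_integrable:
  assumes "g \<in> l2 M K" "\<And>x. x \<notin> E n \<Longrightarrow> g x = 0"
  shows "integrable M g"
  by (rule l2_integrable_finite_support[OF assms(1) E_sets E_finite assms(2)])

text \<open>By \<open>Gram_form\<close> with \<open>a = b = g\<close> and both kernels equal to
  \<Phi>, the squared norm of \<open>T g\<close> is exactly the double integral estimated in
  \<open>form_bound\<close>.\<close>

lemma T_l2_supported:
  assumes g: "g \<in> l2 M UNIV" and supp: "\<And>x. x \<notin> E n \<Longrightarrow> g x = 0"
  shows "T g \<in> l2 M UNIV" "l2_norm M (T g) \<le> C * l2_norm M g"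
proof -
  have [measurable]: "g \<in> borel_measurable M" using g by (rule l2_measurable)
  have row': "(\<lambda>t. \<Phi> t x) \<in> l2 M UNIV" "l2_norm M (\<lambda>t. \<Phi> t x) \<le> A" if "x \<in> space M" for x
    using row[OF that] row_bound[OF that] by (simp_all add: sym[of _ x])
  note G = Gram_form[OF sigma_finite_measure_axioms sigma_finite_measure_axioms meas meas row' row'
      supported_integrable[OF g supp] supported_integrable[OF g supp] T_integrable[OF g] T_integrable[OF g]]
  have sq: "(LINT x|M. g x *\<^sub>R \<Phi> t x) \<bullet> (LINT y|M. g y *\<^sub>R \<Phi> t y) = (norm (T g t))\<^sup>2" for t
    by (simp add: integral_op_def power2_norm_eq_inner)
  show "T g \<in> l2 M UNIV"
    by (rule l2_I) (use G(1) in \<open>simp_all add: sq\<close>)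
  have "(l2_norm M (T g))\<^sup>2 \<le> (C * l2_norm M g)\<^sup>2"
    using form_bound[OF g supp G(2)] G(3) by (simp add: sq l2_norm_power2)
  then show "l2_norm M (T g) \<le> C * l2_norm M g"
    by (rule power2_le_imp_le) (simp add: C_nonneg)
qed

lemma trunc_norm_le:
  fixes g :: "'a \<Rightarrow> 'c::{real_inner, banach, second_countable_topology}"
  assumes g: "g \<in> l2 M K"
  shows "l2_norm M (trunc n g) \<le> l2_norm M g"
proof -
  have [measurable]: "g \<in> borel_measurable M" using g by (rule l2_measurable)
  show ?thesis
    by (rule l2_dominated(2)[OF _ g]) (auto simp: trunc_def indicator_def)
qed

text \<open>Evaluating \<open>T\<close> at a point is a bounded functional, with norm at most
  \<open>A\<close> by the row bound, so convergence of the truncations in norm gives convergence at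
  every point.\<close>

lemma T_trunc_tendsto:
  assumes g: "g \<in> l2 M UNIV" and x: "x \<in> space M"
  shows "(\<lambda>n. T (trunc n g) x) \<longlonglongrightarrow> T g x"
proof (rule LIM_zero_cancel, rule Lim_null_comparison)
  show "\<forall>\<^sub>F n in sequentially. norm (T (trunc n g) x - T g x) \<le> l2_norm M (\<lambda>x. g x - trunc n g x) * A"
    using T_bound[OF l2_diff[OF g trunc_l2[OF g]] x] T_diff[OF g trunc_l2[OF g] x]
    by (simp add: norm_minus_commute)
  show "(\<lambda>n. l2_norm M (\<lambda>x. g x - trunc n g x) * A) \<longlonglongrightarrow> 0"
    using tendsto_mult_left_zero[OF trunc_tendsto[OF g]] .
qed

text \<open>Fatou's lemma for the squared norms. It carries bounds over from truncations to their
  pointwise limit, without any dominating function.\<close>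

lemma bounded_nn_integral_l2:
  fixes f :: "'a \<Rightarrow> 'c::{real_inner, banach, second_countable_topology}"
  assumes f [measurable]: "f \<in> borel_measurable M" and B: "0 \<le> B"
    and fn: "\<And>n. h n \<in> l2 M UNIV" and le: "\<And>n. l2_norm M (h n) \<le> B"
    and lim: "\<And>x. x \<in> space M \<Longrightarrow> (\<lambda>n. h n x) \<longlonglongrightarrow> f x"
  shows "f \<in> l2 M UNIV" "l2_norm M f \<le> B"
proof -
  have [measurable]: "h n \<in> borel_measurable M" for n using fn by (rule l2_measurable)
  have "(\<integral>\<^sup>+x. ennreal ((norm (f x))\<^sup>2) \<partial>M) = (\<integral>\<^sup>+x. liminf (\<lambda>n. ennreal ((norm (h n x))\<^sup>2)) \<partial>M)"
  proof (intro nn_integral_cong)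
    fix x assume "x \<in> space M"
    then have "(\<lambda>n. ennreal ((norm (h n x))\<^sup>2)) \<longlonglongrightarrow> ennreal ((norm (f x))\<^sup>2)"
      by (intro tendsto_ennrealI tendsto_power tendsto_norm lim)
    then show "ennreal ((norm (f x))\<^sup>2) = liminf (\<lambda>n. ennreal ((norm (h n x))\<^sup>2))"
      by (rule lim_imp_Liminf[OF trivial_limit_sequentially, symmetric])
  qed
  also have "\<dots> \<le> liminf (\<lambda>n. \<integral>\<^sup>+x. ennreal ((norm (h n x))\<^sup>2) \<partial>M)"
    by (rule nn_integral_liminf) measurable
  also have "\<dots> \<le> liminf (\<lambda>n::nat. ennreal (B\<^sup>2))"
  proof (intro Liminf_mono always_eventually allI)
    fix n
    have "(\<integral>\<^sup>+x. ennreal ((norm (h n x))\<^sup>2) \<partial>M) = ennreal ((l2_norm M (h n))\<^sup>2)"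
      unfolding l2_norm_power2 by (intro nn_integral_eq_integral l2_integrable_power2[OF fn]) simp
    also have "\<dots> \<le> ennreal (B\<^sup>2)"
      by (intro ennreal_leI power_mono le) simp
    finally show "(\<integral>\<^sup>+x. ennreal ((norm (h n x))\<^sup>2) \<partial>M) \<le> ennreal (B\<^sup>2)" .
  qed
  also have "\<dots> = ennreal (B\<^sup>2)" by (simp add: Liminf_const)
  finally have *: "(\<integral>\<^sup>+x. ennreal ((norm (f x))\<^sup>2) \<partial>M) \<le> ennreal (B\<^sup>2)" .
  show f2: "f \<in> l2 M UNIV"
    by (rule l2_I[OF f], rule integrableI_bounded) (use le_less_trans[OF *] in auto)
  have "ennreal ((l2_norm M f)\<^sup>2) \<le> ennreal (B\<^sup>2)"
    using * unfolding l2_norm_power2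
    by (subst (asm) nn_integral_eq_integral[OF l2_integrable_power2[OF f2]]) simp_all
  then have "(l2_norm M f)\<^sup>2 \<le> B\<^sup>2" by (simp add: ennreal_le_iff)
  then show "l2_norm M f \<le> B" using B by (rule power2_le_imp_le)
qed

text \<open>The functions \<open>T (trunc n g)\<close> are bounded in norm by
  \<open>C * l2_norm M g\<close> independently of \<open>n\<close> and converge pointwise to
  \<open>T g\<close>, so \<open>bounded_nn_integral_l2\<close> applies.\<close>

lemma
  assumes g: "g \<in> l2 M UNIV"
  shows T_l2: "T g \<in> l2 M UNIV" and T_l2_bound: "l2_norm M (T g) \<le> C * l2_norm M g"
proof -
  have [measurable]: "g \<in> borel_measurable M" using g by (rule l2_measurable)
  have le: "l2_norm M (T (trunc n g)) \<le> C * l2_norm M g" for n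
    using T_l2_supported(2)[OF trunc_l2[OF g] trunc_outside] mult_left_mono[OF trunc_norm_le[OF g] C_nonneg]
    by (rule order_trans)
  have B: "0 \<le> C * l2_norm M g" by (simp add: C_nonneg)
  note * = bounded_nn_integral_l2[OF T_measurable B T_l2_supported(1)[OF trunc_l2[OF g] trunc_outside]
      le T_trunc_tendsto[OF g]]
  show "T g \<in> l2 M UNIV" "l2_norm M (T g) \<le> C * l2_norm M g" by (rule *; simp)+
qed

text \<open>Interchange of the two integrations. Since \<open>g\<close> is integrable and the inner
  integral over \<open>t\<close> is at most \<open>A * l2_norm M h\<close>, the double integral
  converges absolutely.\<close>

lemma adjoint_supported:
  assumes h: "h \<in> l2 M UNIV" and g: "g \<in> l2 M UNIV" and supp: "\<And>x. x \<notin> E n \<Longrightarrow> g x = 0"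
  shows "l2_inner M (S h) g = l2_inner M h (T g)"
proof -
  interpret P: pair_sigma_finite M M ..
  have [measurable]: "g \<in> borel_measurable M" using g by (rule l2_measurable)
  have [measurable]: "h \<in> borel_measurable M" using h by (rule l2_measurable)
  define F where "F = (\<lambda>y t. g y * (\<Phi> y t \<bullet> h t))"
  have [measurable]: "case_prod F \<in> borel_measurable (M \<Otimes>\<^sub>M M)" unfolding F_def by measurable
  have int: "integrable (M \<Otimes>\<^sub>M M) (case_prod F)"
  proof (rule P.Fubini_integrable)
    show "integrable M (\<lambda>y. LINT t|M. norm (case_prod F (y, t)))"
    proof (rule Bochner_Integration.integrable_bound)
      show "integrable M (\<lambda>y. norm (g y) * (A * l2_norm M h))"
        using supported_integrable[OF g supp] by simp
      show "AE y in M. norm (LINT t|M. norm (case_prod F (y, t))) \<le> norm (norm (g y) * (A * l2_norm M h))"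
      proof (rule AE_I2)
        fix y assume y: "y \<in> space M"
        have "(LINT t|M. \<bar>\<Phi> y t \<bullet> h t\<bar>) \<le> (LINT t|M. norm (\<Phi> y t) * norm (h t))"
          using l2_inner_integrable[OF row[OF y] h] l2_integrable_mult_norm[OF row[OF y] h]
          by (intro integral_mono) (auto simp: Cauchy_Schwarz_ineq2)
        also have "\<dots> \<le> l2_norm M (\<Phi> y) * l2_norm M h" by (rule l2_Cauchy_Schwarz[OF row[OF y] h])
        also have "\<dots> \<le> A * l2_norm M h" by (intro mult_right_mono row_bound y) simp
        finally have *: "(LINT t|M. \<bar>\<Phi> y t \<bullet> h t\<bar>) \<le> A * l2_norm M h" .
        have "norm (LINT t|M. norm (case_prod F (y, t))) = \<bar>g y\<bar> * (LINT t|M. \<bar>\<Phi> y t \<bullet> h t\<bar>)"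
          by (simp add: F_def abs_mult integral_nonneg_AE)
        also have "\<dots> \<le> \<bar>g y\<bar> * (A * l2_norm M h)" by (intro mult_left_mono *) simp
        also have "\<dots> \<le> norm (norm (g y) * (A * l2_norm M h))"
          by (simp add: abs_mult mult_left_mono mult_right_mono)
        finally show "norm (LINT t|M. norm (case_prod F (y, t))) \<le> norm (norm (g y) * (A * l2_norm M h))" .
      qed
    qed measurable
    show "AE y in M. integrable M (\<lambda>t. case_prod F (y, t))"
      by (rule AE_I2) (use l2_inner_integrable[OF row h] in \<open>simp add: F_def\<close>)
  qed simp
  have "l2_inner M (S h) g = (LINT y|M. LINT t|M. F y t)"
    by (simp add: l2_inner_def S_def F_def mult.commute)
  also have "\<dots> = (LINT t|M. LINT y|M. F y t)"
    by (rule P.Fubini_integral[OF int, symmetric])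
  also have "\<dots> = (LINT t|M. LINT y|M. h t \<bullet> (g y *\<^sub>R \<Phi> t y))"
    by (simp add: F_def sym[of _ t for t] inner_commute)
  also have "\<dots> = l2_inner M h (T g)"
    unfolding l2_inner_def integral_op_def
    by (intro Bochner_Integration.integral_cong refl integral_inner_right) (use T_integrable[OF g] in auto)
  finally show ?thesis .
qed

text \<open>Duality: \<open>S h\<close> is tested against its own truncation, the test is moved over
  to \<open>T\<close>, where the bound \<open>C\<close> is known, and one factor of the norm is
  cancelled. Fatou's lemma then removes the truncation.\<close>

lemma
  assumes h: "h \<in> l2 M UNIV"
  shows S_l2: "S h \<in> l2 M UNIV" and S_l2_bound: "l2_norm M (S h) \<le> C * l2_norm M h"
proof -
  have [measurable]: "h \<in> borel_measurable M" using h by (rule l2_measurable)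
  let ?g = "\<lambda>n. trunc n (S h)"
  have g: "?g n \<in> l2 M UNIV" for n
  \<comment> \<open>The truncation is square integrable before anything is known about
    \<open>S h\<close> in the mean, because \<open>S h\<close> is bounded pointwise by
    \<open>S_bound\<close> and \<open>E n\<close> has finite measure.\<close>
  proof (rule l2_dominated(1))
    have "integrable M (\<lambda>x. indicator (E n) x * (A * l2_norm M h)\<^sup>2)"
      using E_finite[of n] by (intro integrable_mult_left) auto
    moreover have "(norm (indicator (E n) x * (A * l2_norm M h)))\<^sup>2 = indicator (E n) x * (A * l2_norm M h)\<^sup>2" for x
      by (simp add: indicator_def)
    ultimately show "(\<lambda>x. indicator (E n) x * (A * l2_norm M h)) \<in> l2 M UNIV"
      by (intro l2_I) simp_all
    show "norm (trunc n (S h) x) \<le> norm (indicator (E n) x * (A * l2_norm M h))" if "x \<in> space M" for x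
      using S_bound[OF h that] by (simp add: trunc_def indicator_def)
  qed measurable
  have le: "l2_norm M (?g n) \<le> C * l2_norm M h" for n
  proof -
    have "(l2_norm M (?g n))\<^sup>2 = l2_inner M (S h) (?g n)"
      unfolding l2_norm_power2 l2_inner_def
      by (intro Bochner_Integration.integral_cong) (auto simp: trunc_def indicator_def power2_eq_square)
    also have "\<dots> = l2_inner M h (T (?g n))"
      by (rule adjoint_supported[OF h g trunc_outside])
    also have "\<dots> \<le> l2_norm M h * l2_norm M (T (?g n))"
      using l2_inner_bound[OF h T_l2[OF g]] by (simp add: l2_inner_def abs_le_iff)
    also have "\<dots> \<le> l2_norm M h * (C * l2_norm M (?g n))"
      by (intro mult_left_mono T_l2_bound g) simp
    finally have "l2_norm M (?g n) * l2_norm M (?g n) \<le> (C * l2_norm M h) * l2_norm M (?g n)"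
      by (simp add: power2_eq_square ac_simps)
    then show ?thesis
      using l2_norm_nonneg[of M "?g n"] by (cases "l2_norm M (?g n) = 0") (auto simp: C_nonneg)
  qed
  have B: "0 \<le> C * l2_norm M h" by (simp add: C_nonneg)
  have lim: "(\<lambda>n. ?g n x) \<longlonglongrightarrow> S h x" if "x \<in> space M" for x
    by (rule tendsto_eventually[OF trunc_eventually[OF that]])
  note * = bounded_nn_integral_l2[OF S_measurable B g le lim]
  show "S h \<in> l2 M UNIV" "l2_norm M (S h) \<le> C * l2_norm M h" by (rule *; simp)+
qed

text \<open>Both sides are continuous in \<open>g\<close> now that \<open>T\<close> and
  \<open>S\<close> are bounded, and they agree on the truncations of \<open>g\<close>.\<close>

lemma adjoint:
  assumes h: "h \<in> l2 M UNIV" and g: "g \<in> l2 M UNIV"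
  shows "l2_inner M (S h) g = l2_inner M h (T g)"
proof -
  let ?d = "\<lambda>n x. g x - trunc n g x"
  have d: "?d n \<in> l2 M UNIV" for n by (rule l2_diff[OF g trunc_l2[OF g]])
  \<comment> \<open>The contribution of \<open>trunc n g\<close> to the two sides is the same by
    \<open>adjoint_supported\<close>; the remainder \<open>?d n\<close> alone is left.\<close>
  have eq: "l2_inner M (S h) g - l2_inner M h (T g) = l2_inner M (S h) (?d n) - l2_inner M h (T (?d n))" for n
  proof -
    have "l2_inner M (S h) (?d n) = l2_inner M (S h) g - l2_inner M (S h) (trunc n g)"
      unfolding l2_inner_def
      using l2_inner_integrable[OF S_l2[OF h] g] l2_inner_integrable[OF S_l2[OF h] trunc_l2[OF g]]
      by (simp add: right_diff_distrib)
    moreover have "l2_inner M h (T (?d n)) = (LINT x|M. h x \<bullet> T g x - h x \<bullet> T (trunc n g) x)"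
      unfolding l2_inner_def
      by (intro Bochner_Integration.integral_cong refl)
        (simp add: T_diff[OF g trunc_l2[OF g]] inner_diff_right)
    then have "l2_inner M h (T (?d n)) = l2_inner M h (T g) - l2_inner M h (T (trunc n g))"
      using l2_inner_integrable[OF h T_l2[OF g]] l2_inner_integrable[OF h T_l2[OF trunc_l2[OF g]]]
      by (simp add: l2_inner_def)
    ultimately show ?thesis
      using adjoint_supported[OF h trunc_l2[OF g] trunc_outside, of n] by simp
  qed
  have bd: "\<bar>l2_inner M (S h) g - l2_inner M h (T g)\<bar> \<le> 2 * C * l2_norm M h * l2_norm M (?d n)" for n
  proof -
    have "\<bar>l2_inner M (S h) (?d n)\<bar> \<le> (C * l2_norm M h) * l2_norm M (?d n)"
      using l2_inner_bound[OF S_l2[OF h] d] mult_right_mono[OF S_l2_bound[OF h] l2_norm_nonneg]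
      unfolding l2_inner_def by (rule order_trans)
    moreover have "\<bar>l2_inner M h (T (?d n))\<bar> \<le> l2_norm M h * (C * l2_norm M (?d n))"
      using l2_inner_bound[OF h T_l2[OF d]] mult_left_mono[OF T_l2_bound[OF d] l2_norm_nonneg]
      unfolding l2_inner_def by (rule order_trans)
    ultimately show ?thesis unfolding eq[of n] by (simp add: ac_simps)
  qed
  have "(\<lambda>n. 2 * C * l2_norm M h * l2_norm M (?d n)) \<longlonglongrightarrow> 0"
    by (rule tendsto_mult_right_zero[OF trunc_tendsto[OF g]])
  then have "\<bar>l2_inner M (S h) g - l2_inner M h (T g)\<bar> \<le> 0"
    by (rule LIMSEQ_le_const) (use bd in auto)
  then show ?thesis by simp
qed

text \<open>The value of \<open>S (T g)\<close> at \<open>x\<close> is the inner product of the row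
  \<open>\<Phi> x\<close> with \<open>T g\<close>. Moving \<open>T\<close> to the other side by
  \<open>adjoint\<close> puts \<open>S (\<Phi> x)\<close> in its place, and that function is the
  Gram kernel with \<open>x\<close> fixed. Its membership in \<open>l2\<close> also yields the
  integrability, at every \<open>x\<close> and for \<open>g\<close> of unrestricted support.\<close>

lemma S_T:
  assumes g: "g \<in> l2 M UNIV" and x: "x \<in> space M"
  shows "S (T g) x = (LINT y|M. g y * (LINT t|M. \<Phi> t x \<bullet> \<Phi> t y))"
    and "integrable M (\<lambda>y. g y * (LINT t|M. \<Phi> t x \<bullet> \<Phi> t y))"
proof -
  have *: "S (\<Phi> x) y = (LINT t|M. \<Phi> t x \<bullet> \<Phi> t y)" for y
    by (simp add: S_def sym[of x] sym[of y] inner_commute)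
  have "S (T g) x = l2_inner M (S (\<Phi> x)) g"
    unfolding adjoint[OF row[OF x] g] by (simp add: S_def l2_inner_def)
  then show "S (T g) x = (LINT y|M. g y * (LINT t|M. \<Phi> t x \<bullet> \<Phi> t y))"
    by (simp add: l2_inner_def * mult.commute)
  show "integrable M (\<lambda>y. g y * (LINT t|M. \<Phi> t x \<bullet> \<Phi> t y))"
    using l2_inner_integrable[OF g S_l2[OF row[OF x]]] by (simp add: *)
qed

lemma T_continuous: "l2_continuous M T"
  unfolding l2_continuous_def
proof (intro ballI allI impI)
  fix f :: "'a \<Rightarrow> real" and e :: real assume f: "f \<in> l2 M UNIV" and e: "0 < e"
  show "\<exists>\<delta>>0. \<forall>g\<in>l2 M UNIV. l2_norm M (\<lambda>x. g x - f x) < \<delta> \<longrightarrow> l2_norm M (\<lambda>x. T g x - T f x) < e"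
  \<comment> \<open>\<open>C + 1\<close> instead of \<open>C\<close>, as \<open>C\<close> may be
    \<open>0\<close>.\<close>
  proof (intro exI[of _ "e / (C + 1)"] conjI ballI impI)
    show "0 < e / (C + 1)" using e C_nonneg by simp
    fix g :: "'a \<Rightarrow> real" assume g: "g \<in> l2 M UNIV" and lt: "l2_norm M (\<lambda>x. g x - f x) < e / (C + 1)"
    have "l2_norm M (\<lambda>x. T g x - T f x) = l2_norm M (T (\<lambda>x. g x - f x))"
      unfolding l2_norm_def' by (intro arg_cong[of _ _ sqrt] Bochner_Integration.integral_cong)
        (simp_all add: T_diff[OF g f])
    also have "\<dots> \<le> C * l2_norm M (\<lambda>x. g x - f x)" by (rule T_l2_bound[OF l2_diff[OF g f]])
    also have "\<dots> \<le> (C + 1) * l2_norm M (\<lambda>x. g x - f x)" by (simp add: mult_right_mono)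
    also have "\<dots> < e" using lt C_nonneg by (simp add: field_simps)
    finally show "l2_norm M (\<lambda>x. T g x - T f x) < e" .
  qed
qed

text \<open>A vector orthogonal to \<open>K\<close> is orthogonal to the integrand and hence to the
  integral; a subspace of a Euclidean space is its own double orthogonal complement.\<close>

lemma T_in_subspace:
  assumes K: "subspace K" and in_K: "\<And>x y. x \<in> space M \<Longrightarrow> y \<in> space M \<Longrightarrow> \<Phi> x y \<in> K"
    and g: "g \<in> l2 M UNIV" and x: "x \<in> space M"
  shows "T g x \<in> K"
proof -
  have "orthogonal w (T g x)" if w: "w \<in> K\<^sup>\<bottom>" for w
  proof -
    have "w \<bullet> T g x = (LINT y|M. w \<bullet> (g y *\<^sub>R \<Phi> x y))"
      unfolding integral_op_def by (rule integral_inner_right[symmetric]) (rule T_integrable[OF g x])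
    also have "\<dots> = (LINT y|M. 0)"
      using w in_K[OF x] by (intro Bochner_Integration.integral_cong)
        (auto simp: orthogonal_comp_def orthogonal_def inner_commute)
    finally show ?thesis by (simp add: orthogonal_def)
  qed
  then have "T g x \<in> K\<^sup>\<bottom>\<^sup>\<bottom>" by (auto simp: orthogonal_comp_def)
  then show ?thesis using orthogonal_comp_self[OF K] by simp
qed

end

section \<open>The Hilbert transform form\<close>

text \<open>The fundamental theorem of calculus with antiderivative
  \<open>- exp (- (c * s)) / c\<close>, which tends to \<open>0\<close> at infinity because the
  modulus of the exponential is \<open>exp (- (s * Re c))\<close>.\<close>

lemma LBINT_exp_complex:
  fixes c :: complex
  assumes c: "0 < Re c"
  shows "set_integrable lborel {0<..} (\<lambda>s. exp (- (c * of_real s)))"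
    and "(LINT s:{0<..}|lborel. exp (- (c * of_real s))) = 1 / c"
proof -
  have c0: "c \<noteq> 0" using c by auto
  have nrm: "norm (exp (- (c * of_real s))) = exp (- (s * Re c))" for s
    by (simp add: mult.commute)
  show int: "set_integrable lborel {0<..} (\<lambda>s. exp (- (c * of_real s)))"
    unfolding set_integrable_def
  proof (rule Bochner_Integration.integrable_bound)
    show "integrable lborel (\<lambda>s. indicator {0<..} s *\<^sub>R exp (- (s * Re c)))"
      using integrable_I0i_exp_mscale[OF c] by (simp add: set_integrable_def)
  qed (auto simp: nrm simp del: norm_exp_eq_Re)
  have "(LBINT s=0..\<infinity>. exp (- (c * of_real s))) = 0 - (- 1 / c)"
  proof (rule interval_integral_FTC_integrable[where F = "\<lambda>s. - exp (- (c * of_real s)) / c"])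
    show "((\<lambda>s. - exp (- (c * of_real s)) / c) has_vector_derivative exp (- (c * of_real s))) (at s)" for s
      by (rule has_vector_derivative_real_field) (use c0 in \<open>auto intro!: derivative_eq_intros\<close>)
    show "isCont (\<lambda>s. exp (- (c * of_real s))) s" for s by (intro continuous_intros)
    show "set_integrable lborel (einterval 0 \<infinity>) (\<lambda>s. exp (- (c * of_real s)))"
      using int by (simp add: zero_ereal_def)
    have "isCont (\<lambda>s::real. - exp (- (c * of_real s)) / c) 0" using c0 by (intro continuous_intros)
    then have "((\<lambda>s. - exp (- (c * of_real s)) / c) \<longlongrightarrow> - 1 / c) (at_right (0::real))"
      unfolding isCont_def by (simp add: filterlim_at_split)
    then show "(((\<lambda>s. - exp (- (c * of_real s)) / c) \<circ> real_of_ereal) \<longlongrightarrow> - 1 / c) (at_right 0)"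
      by (simp add: zero_ereal_def ereal_tendsto_simps)
    have *: "((\<lambda>s. exp (- (s * Re c))) \<longlongrightarrow> 0) at_top"
      using c by (auto intro!: exp_at_bot[THEN filterlim_compose] filterlim_tendsto_pos_mult_at_top filterlim_ident
             simp: filterlim_uminus_at_bot mult.commute[of _ "Re c"])
    have "((\<lambda>s::real. exp (- (c * of_real s))) \<longlongrightarrow> 0) at_top"
      by (rule tendsto_norm_zero_cancel) (simp only: nrm *)
    from tendsto_minus[OF tendsto_divide[OF this tendsto_const c0]]
    have "((\<lambda>s::real. - exp (- (c * of_real s)) / c) \<longlongrightarrow> 0) at_top" by simp
    then show "(((\<lambda>s. - exp (- (c * of_real s)) / c) \<circ> real_of_ereal) \<longlongrightarrow> 0) (at_left \<infinity>)"
      by (simp add: ereal_tendsto_simps)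
  qed auto
  then show "(LINT s:{0<..}|lborel. exp (- (c * of_real s))) = 1 / c"
    by (simp add: interval_lebesgue_integral_0_infty)
qed

section \<open>Poisson and regularised Hilbert kernels as Fourier transforms\<close>

abbreviation exp_measure :: "real \<Rightarrow> real measure" where
  "exp_measure \<epsilon> \<equiv> density lborel (exponential_density \<epsilon>)"

lemma exp_measure_char:
  assumes e: "0 < \<epsilon>"
  shows "(LINT s|exp_measure \<epsilon>. cis (s * \<tau>)) = of_real \<epsilon> / Complex \<epsilon> (- \<tau>)"
proof -
  let ?c = "Complex \<epsilon> (- \<tau>)"
  have "(LINT s|exp_measure \<epsilon>. cis (s * \<tau>)) = (LINT s|lborel. exponential_density \<epsilon> s *\<^sub>R cis (s * \<tau>))"
    using e by (intro integral_density) (auto simp: exponential_density_nonneg intro!: borel_measurable_continuous_onI continuous_intros)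
  also have "\<dots> = (LINT s|lborel. of_real \<epsilon> * (indicator {0<..} s *\<^sub>R exp (- (?c * of_real s))))"
  proof (rule integral_cong_AE)
    show "(\<lambda>s. exponential_density \<epsilon> s *\<^sub>R cis (s * \<tau>)) \<in> borel_measurable lborel"
      by (intro borel_measurable_scaleR) (auto intro!: borel_measurable_continuous_onI continuous_intros)
    show "(\<lambda>s. of_real \<epsilon> * (indicator {0<..} s *\<^sub>R exp (- (?c * of_real s)))) \<in> borel_measurable lborel"
      by measurable
    \<comment> \<open>At \<open>s = 0\<close> the density is \<open>\<epsilon>\<close> while the
      indicator of the open half-line is \<open>0\<close>, so the identity fails at this one
      point.\<close>
    show "AE s in lborel. exponential_density \<epsilon> s *\<^sub>R cis (s * \<tau>) = of_real \<epsilon> * (indicator {0<..} s *\<^sub>R exp (- (?c * of_real s)))"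
      using AE_lborel_singleton[of 0]
    proof eventually_elim
      fix s :: real assume "s \<noteq> 0"
      have "exp (- (?c * of_real s)) = of_real (exp (- (s * \<epsilon>))) * cis (s * \<tau>)"
        by (simp add: exp_eq_polar ac_simps)
      then show "exponential_density \<epsilon> s *\<^sub>R cis (s * \<tau>) = of_real \<epsilon> * (indicator {0<..} s *\<^sub>R exp (- (?c * of_real s)))"
        using \<open>s \<noteq> 0\<close> by (auto simp: exponential_density_def indicator_def scaleR_conv_of_real)
    qed
  qed
  also have "\<dots> = of_real \<epsilon> * (1 / ?c)"
    using LBINT_exp_complex(2)[of ?c] e
    by (simp only: integral_mult_right_zero set_lebesgue_integral_def complex.sel)
  finally show ?thesis by simp
qed

text \<open>Real and imaginary parts of the characteristic function. Up to normalisation these are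
  the Poisson kernel and the regularised Hilbert kernel; the additional factor \<epsilon> is there
  because \<open>exp_measure\<close> has total mass \<open>1\<close>.\<close>

lemma exp_measure_cos_sin:
  assumes e: "0 < \<epsilon>"
  shows "(LINT s|exp_measure \<epsilon>. cos (s * \<tau>)) = \<epsilon>\<^sup>2 / (\<tau>\<^sup>2 + \<epsilon>\<^sup>2)"
    and "(LINT s|exp_measure \<epsilon>. sin (s * \<tau>)) = \<epsilon> * (\<tau> / (\<tau>\<^sup>2 + \<epsilon>\<^sup>2))"
proof -
  interpret prob_space "exp_measure \<epsilon>" by (rule prob_space_exponential_density[OF e])
  have int: "integrable (exp_measure \<epsilon>) (\<lambda>s. cis (s * \<tau>))"
    by (rule integrable_const_bound[where B = 1]) (auto intro!: borel_measurable_continuous_onI continuous_intros)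
  have eq: "of_real \<epsilon> / Complex \<epsilon> (- \<tau>) = Complex (\<epsilon>\<^sup>2 / (\<tau>\<^sup>2 + \<epsilon>\<^sup>2)) (\<epsilon> * (\<tau> / (\<tau>\<^sup>2 + \<epsilon>\<^sup>2)))"
    by (simp add: complex_eq_iff Re_divide Im_divide power2_eq_square add.commute)
  show "(LINT s|exp_measure \<epsilon>. cos (s * \<tau>)) = \<epsilon>\<^sup>2 / (\<tau>\<^sup>2 + \<epsilon>\<^sup>2)"
    using integral_Re[OF int] unfolding exp_measure_char[OF e] eq by simp
  show "(LINT s|exp_measure \<epsilon>. sin (s * \<tau>)) = \<epsilon> * (\<tau> / (\<tau>\<^sup>2 + \<epsilon>\<^sup>2))"
    using integral_Im[OF int] unfolding exp_measure_char[OF e] eq by simp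
qed

text \<open>The affine substitution by \<open>(x - y) / \<epsilon>\<close> reduces both claims to
  the integral of \<open>1 / (1 + x\<^sup>2)\<close> over the line.\<close>

lemma Poisson_kernel_integral:
  assumes e: "0 < (\<epsilon>::real)"
  shows "integrable lborel (\<lambda>y. \<epsilon>\<^sup>2 / ((x - y)\<^sup>2 + \<epsilon>\<^sup>2))"
    and "(LINT y|lborel. \<epsilon>\<^sup>2 / ((x - y)\<^sup>2 + \<epsilon>\<^sup>2)) = \<epsilon> * pi"
proof -
  have i: "integrable lborel (\<lambda>x::real. inverse (1 + x\<^sup>2))"
    using integrable_inverse_1_plus_square by (simp add: set_integrable_def)
  have v: "(LINT x|lborel. inverse (1 + x\<^sup>2)) = pi"
    using LBINT_inverse_1_plus_square by (simp add: interval_lebesgue_integral_def set_lebesgue_integral_def)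
  have eq: "inverse (1 + (x / \<epsilon> + (- 1 / \<epsilon>) * y)\<^sup>2) = \<epsilon>\<^sup>2 / ((x - y)\<^sup>2 + \<epsilon>\<^sup>2)" for y
  proof -
    have "x / \<epsilon> + (- 1 / \<epsilon>) * y = (x - y) / \<epsilon>" by (simp add: diff_divide_distrib)
    moreover have "(x - y)\<^sup>2 + \<epsilon>\<^sup>2 \<noteq> 0" using e by (simp add: sum_power2_eq_zero_iff)
    ultimately show ?thesis using e by (simp add: power_divide field_simps)
  qed
  show "integrable lborel (\<lambda>y. \<epsilon>\<^sup>2 / ((x - y)\<^sup>2 + \<epsilon>\<^sup>2))"
    using lborel_integrable_real_affine_iff[of "- 1 / \<epsilon>" "\<lambda>x. inverse (1 + x\<^sup>2)" "x / \<epsilon>"] i e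
    unfolding eq by simp
  show "(LINT y|lborel. \<epsilon>\<^sup>2 / ((x - y)\<^sup>2 + \<epsilon>\<^sup>2)) = \<epsilon> * pi"
    using lborel_integral_real_affine[of "- 1 / \<epsilon>" "\<lambda>x. inverse (1 + x\<^sup>2)" "x / \<epsilon>"] v e
    unfolding eq by (simp add: field_simps)
qed

text \<open>Schur's test: the product \<open>a x * a y\<close> is at most the mean of the squares,
  and the nonnegative symmetric kernel has integral \<open>\<epsilon> * pi\<close> in each
  variable.\<close>

lemma Poisson_form_bound:
  assumes e: "0 < (\<epsilon>::real)" and a: "a \<in> l2 lborel UNIV"
    and int: "integrable (lborel \<Otimes>\<^sub>M lborel) (\<lambda>(x, y). a x * a y * (\<epsilon>\<^sup>2 / ((x - y)\<^sup>2 + \<epsilon>\<^sup>2)))"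
  shows "(LINT p|(lborel \<Otimes>\<^sub>M lborel). (case p of (x, y) \<Rightarrow> a x * a y * (\<epsilon>\<^sup>2 / ((x - y)\<^sup>2 + \<epsilon>\<^sup>2))))
    \<le> \<epsilon> * pi * (l2_norm lborel a)\<^sup>2"
proof -
  have [measurable]: "a \<in> borel_measurable borel" using l2_measurable[OF a] by simp
  define P where "P = (\<lambda>x y::real. \<epsilon>\<^sup>2 / ((x - y)\<^sup>2 + \<epsilon>\<^sup>2))"
  have P0: "0 \<le> P x y" for x y by (simp add: P_def)
  have Psym: "P x y = P y x" for x y by (simp add: P_def power2_commute)
  have [measurable]: "case_prod P \<in> borel_measurable (lborel \<Otimes>\<^sub>M lborel)" unfolding P_def by measurable
  have Pi: "integrable lborel (P x)" "integral\<^sup>L lborel (P x) = \<epsilon> * pi" for x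
    using Poisson_kernel_integral[OF e, of x] by (simp_all add: P_def)
  define Q where "Q = (\<lambda>x y. (a x)\<^sup>2 * P x y)"
  have [measurable]: "case_prod Q \<in> borel_measurable (lborel \<Otimes>\<^sub>M lborel)" unfolding Q_def by measurable
  have a2: "integrable lborel (\<lambda>x. (a x)\<^sup>2)" using l2_integrable_power2[OF a] by simp
  have Qi: "integrable (lborel \<Otimes>\<^sub>M lborel) (case_prod Q)"
  proof (rule lborel_pair.Fubini_integrable)
    have "(LINT y|lborel. norm (case_prod Q (x, y))) = (a x)\<^sup>2 * (\<epsilon> * pi)" for x
      using Pi by (simp add: Q_def abs_mult P0)
    then show "integrable lborel (\<lambda>x. LINT y|lborel. norm (case_prod Q (x, y)))" using a2 by simp
    show "AE x in lborel. integrable lborel (\<lambda>y. case_prod Q (x, y))" using Pi(1) by (simp add: Q_def)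
  qed simp
  have Qv: "(LINT p|(lborel \<Otimes>\<^sub>M lborel). case_prod Q p) = \<epsilon> * pi * (l2_norm lborel a)\<^sup>2"
  proof -
    have "(LINT p|(lborel \<Otimes>\<^sub>M lborel). case_prod Q p) = (LINT x|lborel. LINT y|lborel. Q x y)"
      using lborel_pair.integral_fst[OF Qi] by simp
    also have "\<dots> = (LINT x|lborel. (a x)\<^sup>2 * (\<epsilon> * pi))" using Pi by (simp add: Q_def)
    finally show ?thesis by (simp add: l2_norm_power2 mult.commute)
  qed
  have Q'i: "integrable (lborel \<Otimes>\<^sub>M lborel) (\<lambda>(x, y). case_prod Q (y, x))"
    by (rule lborel_pair.integrable_product_swap[OF Qi])
  have Q'v: "(LINT (x, y)|(lborel \<Otimes>\<^sub>M lborel). case_prod Q (y, x)) = \<epsilon> * pi * (l2_norm lborel a)\<^sup>2"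
    by (subst lborel_pair.integral_product_swap) (simp_all add: Qv)
  have "(LINT p|(lborel \<Otimes>\<^sub>M lborel). (case p of (x, y) \<Rightarrow> a x * a y * P x y))
    \<le> (LINT p|(lborel \<Otimes>\<^sub>M lborel). (case_prod Q p + (case p of (x, y) \<Rightarrow> case_prod Q (y, x))) / 2)"
  proof (rule integral_mono)
    show "integrable (lborel \<Otimes>\<^sub>M lborel) (\<lambda>p. case p of (x, y) \<Rightarrow> a x * a y * P x y)"
      using int by (simp add: P_def)
    show "integrable (lborel \<Otimes>\<^sub>M lborel) (\<lambda>p. (case_prod Q p + (case p of (x, y) \<Rightarrow> case_prod Q (y, x))) / 2)"
      using Qi Q'i by simp
    fix p :: "real \<times> real"
    obtain x y where p: "p = (x, y)" by force
    have "a x * a y \<le> ((a x)\<^sup>2 + (a y)\<^sup>2) / 2" using sum_squares_bound[of "a x" "a y"] by simp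
    from mult_right_mono[OF this P0[of x y]]
    show "(case p of (x, y) \<Rightarrow> a x * a y * P x y) \<le> (case_prod Q p + (case p of (x, y) \<Rightarrow> case_prod Q (y, x))) / 2"
      by (simp add: p Q_def Psym[of y x] algebra_simps add_divide_distrib)
  qed
  also have "\<dots> = \<epsilon> * pi * (l2_norm lborel a)\<^sup>2"
    using Qi Q'i Qv Q'v by simp
  finally show ?thesis by (simp add: P_def)
qed

lemma inner_cis: "cis u \<bullet> cis w = cos (u - w)" "cis u \<bullet> (\<i> * cis w) = sin (u - w)"
  by (simp_all add: inner_complex_def cos_diff sin_diff)

text \<open>Let \<open>F\<close> be the Fourier transform, viewed in \<open>l2\<close> of
  \<open>exp_measure \<epsilon>\<close>. Pairing \<open>F f\<close> with itself produces the Poisson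
  form, which bounds the norm of \<open>F\<close>. Pairing \<open>F a\<close> with
  \<open>\<i> * F b\<close> replaces the cosine by the sine and produces \<epsilon> times the
  Hilbert form, so Cauchy-Schwarz bounds the latter.\<close>

lemma regularised_Hilbert_form:
  assumes e: "0 < (\<epsilon>::real)" and a: "a \<in> l2 lborel UNIV" "integrable lborel a"
    and b: "b \<in> l2 lborel UNIV" "integrable lborel b"
  shows "integrable (lborel \<Otimes>\<^sub>M lborel) (\<lambda>(x, y). a x * b y * ((x - y) / ((x - y)\<^sup>2 + \<epsilon>\<^sup>2)))" (is ?int)
    and "\<bar>LINT p|(lborel \<Otimes>\<^sub>M lborel). (case p of (x, y) \<Rightarrow> a x * b y * ((x - y) / ((x - y)\<^sup>2 + \<epsilon>\<^sup>2)))\<bar>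
    \<le> pi * l2_norm lborel a * l2_norm lborel b"
proof -
  let ?N = "exp_measure \<epsilon>" and ?L = "lborel :: real measure"
  interpret N: prob_space ?N by (rule prob_space_exponential_density[OF e])
  define F where "F = (\<lambda>f::real\<Rightarrow>real. \<lambda>s. LINT x|lborel. f x *\<^sub>R cis (s * x))"
  have cism [measurable]: "(\<lambda>p. cis (fst p * snd p)) \<in> borel_measurable (?N \<Otimes>\<^sub>M ?L)"
  proof -
    have "(\<lambda>p::real \<times> real. cis (fst p * snd p)) \<in> borel_measurable borel"
      by (intro borel_measurable_continuous_onI continuous_intros)
    moreover have "sets (?N \<Otimes>\<^sub>M ?L) = sets (borel :: (real \<times> real) measure)"
      unfolding borel_prod[symmetric] by (intro sets_pair_measure_cong) simp_all
    ultimately show ?thesis by (simp cong: measurable_cong_sets)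
  qed
  have cisx: "(\<lambda>s. cis (s * x)) \<in> borel_measurable borel" "(\<lambda>s. cis (x * s)) \<in> borel_measurable borel" for x
    by (intro borel_measurable_continuous_onI continuous_intros)+
  have m: "(\<lambda>(s, x). cis (s * x)) \<in> borel_measurable (?N \<Otimes>\<^sub>M ?L)"
    "(\<lambda>(s, x). \<i> * cis (s * x)) \<in> borel_measurable (?N \<Otimes>\<^sub>M ?L)"
    using cism by (simp_all add: case_prod_beta)
  have l: "(\<lambda>s. cis (s * x)) \<in> l2 ?N UNIV" "(\<lambda>s. \<i> * cis (s * x)) \<in> l2 ?N UNIV"
    "l2_norm ?N (\<lambda>s. cis (s * x)) \<le> 1" "l2_norm ?N (\<lambda>s. \<i> * cis (s * x)) \<le> 1" for x
    using cisx[of x] by (auto intro!: l2_I simp: norm_mult l2_norm_def' N.prob_space)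
  have i: "integrable ?L (\<lambda>x. f x *\<^sub>R cis (s * x))" "integrable ?L (\<lambda>x. f x *\<^sub>R (\<i> * cis (s * x)))"
    if f: "integrable ?L f" for f s
    using cisx[of s] f
    by (auto intro!: Bochner_Integration.integrable_bound[OF f] borel_measurable_scaleR borel_measurable_times
      simp: norm_mult)
  have F_eq: "(LINT x|lborel. f x *\<^sub>R cis (s * x)) = F f s" for f s
    by (simp add: F_def)
  have iF: "(LINT x|lborel. f x *\<^sub>R (\<i> * cis (s * x))) = \<i> * F f s" for f s
    by (simp add: F_def flip: mult_scaleR_right)
  have N: "sigma_finite_measure ?N" ..
  note G1 = Gram_form[OF N sigma_finite_lborel m(1) m(1) l(1) l(3) l(1) l(3) _ _ i(1) i(1)]
  note G2 = Gram_form[OF N sigma_finite_lborel m(1) m(2) l(1) l(3) l(2) l(4) _ _ i(1) i(2)]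
  have cs: "(LINT t|?N. cis (t * x) \<bullet> cis (t * y)) = \<epsilon>\<^sup>2 / ((x - y)\<^sup>2 + \<epsilon>\<^sup>2)"
    "(LINT t|?N. cis (t * x) \<bullet> (\<i> * cis (t * y))) = \<epsilon> * ((x - y) / ((x - y)\<^sup>2 + \<epsilon>\<^sup>2))" for x y
    using exp_measure_cos_sin[OF e, of "x - y"] by (simp_all add: inner_cis right_diff_distrib)
  \<comment> \<open>The squared norm of \<open>F f\<close> is the Poisson form, whence the constant
    \<open>sqrt (\<epsilon> * pi)\<close>.\<close>
  have F: "F f \<in> l2 ?N UNIV" "l2_norm ?N (F f) \<le> sqrt (\<epsilon> * pi) * l2_norm lborel f"
    if f: "f \<in> l2 lborel UNIV" "integrable lborel f" for f
  proof -
    note G = G1[OF f(2) f(2) f(2) f(2), unfolded cs F_eq]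
    show l2F: "F f \<in> l2 ?N UNIV"
    proof (rule l2_I)
      show "integrable ?N (\<lambda>s. (norm (F f s))\<^sup>2)" using G(1) by (simp add: power2_norm_eq_inner)
      have [measurable]: "f \<in> borel_measurable lborel" using f by auto
      show "F f \<in> borel_measurable ?N"
        unfolding F_def by (rule lborel.borel_measurable_lebesgue_integral) (use cism in \<open>simp add: case_prod_beta\<close>)
    qed
    have "(l2_norm ?N (F f))\<^sup>2 \<le> (sqrt (\<epsilon> * pi) * l2_norm lborel f)\<^sup>2"
      using Poisson_form_bound[OF e f(1) G(2)] G(3) e
      by (simp add: l2_norm_power2[of ?N] power2_norm_eq_inner power_mult_distrib)
    then show "l2_norm ?N (F f) \<le> sqrt (\<epsilon> * pi) * l2_norm lborel f"
      by (rule power2_le_imp_le) (use e in simp)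
  qed
  note G = G2[OF a(2) b(2) a(2) b(2), unfolded cs iF F_eq]
  have eqG: "(case p of (x, y) \<Rightarrow> a x * b y * (\<epsilon> * ((x - y) / ((x - y)\<^sup>2 + \<epsilon>\<^sup>2))))
    = \<epsilon> * (case p of (x, y) \<Rightarrow> a x * b y * ((x - y) / ((x - y)\<^sup>2 + \<epsilon>\<^sup>2)))" for p
    by (simp add: case_prod_beta)
  show ?int using G(2) e unfolding eqG by simp
  have iFb: "(\<lambda>s. \<i> * F b s) \<in> l2 ?N UNIV" "l2_norm ?N (\<lambda>s. \<i> * F b s) = l2_norm ?N (F b)"
    using F(1)[OF b] by (auto simp: l2_def l2_norm_def' norm_mult intro!: borel_measurable_times)
  \<comment> \<open>The factor \<epsilon> on the left comes from the sine integral. The two factors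
    \<open>sqrt (\<epsilon> * pi)\<close> below supply the same \<epsilon>, so it cancels and the
    bound is uniform.\<close>
  have "\<epsilon> * \<bar>LINT p|(lborel \<Otimes>\<^sub>M lborel). (case p of (x, y) \<Rightarrow> a x * b y * ((x - y) / ((x - y)\<^sup>2 + \<epsilon>\<^sup>2)))\<bar>
    = \<bar>LINT t|?N. F a t \<bullet> (\<i> * F b t)\<bar>"
    using e unfolding G(3) eqG by (simp add: abs_mult)
  also have "\<dots> \<le> l2_norm ?N (F a) * l2_norm ?N (F b)"
    using l2_inner_bound[OF F(1)[OF a] iFb(1)] iFb(2) by simp
  also have "\<dots> \<le> (sqrt (\<epsilon> * pi) * l2_norm lborel a) * (sqrt (\<epsilon> * pi) * l2_norm lborel b)"
    using e by (intro mult_mono F(2)[OF a] F(2)[OF b]) auto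
  also have "\<dots> = (sqrt (\<epsilon> * pi) * sqrt (\<epsilon> * pi)) * (l2_norm lborel a * l2_norm lborel b)" by simp
  also have "\<dots> = \<epsilon> * (pi * l2_norm lborel a * l2_norm lborel b)"
    using e by (subst real_sqrt_mult_self) simp
  finally show "\<bar>LINT p|(lborel \<Otimes>\<^sub>M lborel). (case p of (x, y) \<Rightarrow> a x * b y * ((x - y) / ((x - y)\<^sup>2 + \<epsilon>\<^sup>2)))\<bar>
    \<le> pi * l2_norm lborel a * l2_norm lborel b"
    using e by simp
qed

text \<open>By \<open>pq\<close> the numerator vanishes on the diagonal to first order. The kernel
  is therefore bounded by \<open>D\<close>, no principal value occurs, and the regularisation can be
  removed by dominated convergence. The constant \<open>D\<close> does not enter the final bound,
  which comes from the regularised forms applied to each coordinate of \<open>p\<close> and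
  \<open>q\<close>.\<close>

lemma Hilbert_commutator_form:
  fixes p q :: "real \<Rightarrow> 'a::euclidean_space" and h :: "real \<Rightarrow> real"
  assumes h: "h \<in> l2 lborel UNIV" "integrable lborel h"
    and [measurable]: "p \<in> borel_measurable borel" "q \<in> borel_measurable borel"
    and p: "\<And>x. norm (p x) \<le> B" and q: "\<And>x. norm (q x) \<le> B"
    and pq: "\<And>x y. \<bar>p x \<bullet> q y\<bar> \<le> D * \<bar>x - y\<bar>"
  shows "integrable (lborel \<Otimes>\<^sub>M lborel) (\<lambda>(x, y). h x * h y * ((p x \<bullet> q y) / (x - y)))" (is ?int)
    and "(LINT z|(lborel \<Otimes>\<^sub>M lborel). (case z of (x, y) \<Rightarrow> h x * h y * ((p x \<bullet> q y) / (x - y))))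
      \<le> of_nat DIM('a) * (pi * B\<^sup>2 * (l2_norm lborel h)\<^sup>2)"
proof -
  let ?LL = "lborel \<Otimes>\<^sub>M lborel :: (real \<times> real) measure"
  have [measurable]: "h \<in> borel_measurable borel" using l2_measurable[OF h(1)] by simp
  have B0: "0 \<le> B" using order_trans[OF norm_ge_zero p] .
  have D0: "0 \<le> D" using order_trans[OF abs_ge_zero pq[of 0 1]] by simp
  define e where "e = (\<lambda>n. inverse (real (Suc n)))"
  have e0: "0 < e n" for n by (simp add: e_def)
  have elim: "e \<longlonglongrightarrow> 0" unfolding e_def by (rule LIMSEQ_inverse_real_of_nat)
  define f where "f = (\<lambda>n z. case z of (x, y) \<Rightarrow> h x * h y * ((p x \<bullet> q y) * ((x - y) / ((x - y)\<^sup>2 + (e n)\<^sup>2))))"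
  have dom_int: "integrable ?LL (\<lambda>z. \<bar>h (fst z)\<bar> * \<bar>h (snd z)\<bar> * D)"
  proof (rule lborel_pair.Fubini_integrable)
    show "integrable lborel (\<lambda>x. LINT y|lborel. norm (\<bar>h (fst (x, y))\<bar> * \<bar>h (snd (x, y))\<bar> * D))"
      using h(2) by (simp add: abs_mult)
  qed (use h(2) in \<open>auto simp: borel_prod\<close>)
  have dom1: "\<bar>h x * h y * ((p x \<bullet> q y) / (x - y))\<bar> \<le> \<bar>h x\<bar> * \<bar>h y\<bar> * D" for x y
  proof (cases "x = y")
    case False
    then have "\<bar>(p x \<bullet> q y) / (x - y)\<bar> \<le> D" using pq[of x y] by (simp add: abs_divide divide_le_eq)
    then have "\<bar>h x * h y\<bar> * \<bar>(p x \<bullet> q y) / (x - y)\<bar> \<le> \<bar>h x * h y\<bar> * D"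
      by (rule mult_left_mono) simp
    then show ?thesis by (simp only: abs_mult)
  qed (simp add: D0)
  have dom2: "\<bar>(p x \<bullet> q y) * ((x - y) / ((x - y)\<^sup>2 + (e n)\<^sup>2))\<bar> \<le> D" for x y n
  proof -
    have pos: "0 < (x - y)\<^sup>2 + (e n)\<^sup>2" using e0[of n] by (simp add: add_nonneg_pos)
    have "\<bar>(p x \<bullet> q y) * ((x - y) / ((x - y)\<^sup>2 + (e n)\<^sup>2))\<bar> = (\<bar>p x \<bullet> q y\<bar> * \<bar>x - y\<bar>) / ((x - y)\<^sup>2 + (e n)\<^sup>2)"
      using pos by (simp add: abs_mult abs_divide)
    also have "\<dots> \<le> (D * \<bar>x - y\<bar> * \<bar>x - y\<bar>) / ((x - y)\<^sup>2 + (e n)\<^sup>2)"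
      using pos by (intro divide_right_mono mult_right_mono pq) auto
    also have "\<dots> \<le> D"
    proof -
      have "D * \<bar>x - y\<bar> * \<bar>x - y\<bar> = D * (x - y)\<^sup>2" by (simp add: power2_eq_square mult.assoc)
      also have "\<dots> \<le> D * ((x - y)\<^sup>2 + (e n)\<^sup>2)" using D0 by (intro mult_left_mono) simp_all
      finally show ?thesis using pos by (simp add: pos_divide_le_eq)
    qed
    finally show ?thesis .
  qed
  have fm [measurable]: "f n \<in> borel_measurable ?LL" for n unfolding f_def by measurable
  show ?int
    by (rule Bochner_Integration.integrable_bound[OF dom_int])
      (use dom1 D0 in \<open>auto simp: case_prod_beta abs_mult\<close>)
  have lim: "(\<lambda>n. integral\<^sup>L ?LL (f n)) \<longlonglongrightarrow> (LINT z|?LL. (case z of (x, y) \<Rightarrow> h x * h y * ((p x \<bullet> q y) / (x - y))))"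
  proof (rule integral_dominated_convergence[OF _ _ dom_int])
    show "AE z in ?LL. (\<lambda>n. f n z) \<longlonglongrightarrow> (case z of (x, y) \<Rightarrow> h x * h y * ((p x \<bullet> q y) / (x - y)))"
    proof (rule AE_I2)
      fix z :: "real \<times> real"
      obtain x y where z: "z = (x, y)" by force
      show "(\<lambda>n. f n z) \<longlonglongrightarrow> (case z of (x, y) \<Rightarrow> h x * h y * ((p x \<bullet> q y) / (x - y)))"
      \<comment> \<open>On the diagonal the regularised kernel is \<open>0\<close>, and so is the
        limit, by division by zero.\<close>
      proof (cases "x = y")
        case False
        have "(\<lambda>n. (x - y) / ((x - y)\<^sup>2 + (e n)\<^sup>2)) \<longlonglongrightarrow> (x - y) / ((x - y)\<^sup>2 + 0\<^sup>2)"
          using False by (intro tendsto_divide tendsto_add tendsto_power elim tendsto_const) auto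
        moreover have "(x - y) / ((x - y)\<^sup>2 + 0\<^sup>2) = 1 / (x - y)"
          using False by (simp add: power2_eq_square)
        ultimately have "(\<lambda>n. h x * h y * ((p x \<bullet> q y) * ((x - y) / ((x - y)\<^sup>2 + (e n)\<^sup>2)))) \<longlonglongrightarrow>
           h x * h y * ((p x \<bullet> q y) * (1 / (x - y)))"
          by (intro tendsto_mult tendsto_const) simp
        then show ?thesis by (simp add: z f_def)
      qed (simp add: z f_def)
    qed
    show "AE z in ?LL. norm (f n z) \<le> \<bar>h (fst z)\<bar> * \<bar>h (snd z)\<bar> * D" for n
    proof (rule AE_I2)
      fix z :: "real \<times> real"
      obtain x y where z: "z = (x, y)" by force
      have "\<bar>h x * h y\<bar> * \<bar>(p x \<bullet> q y) * ((x - y) / ((x - y)\<^sup>2 + (e n)\<^sup>2))\<bar> \<le> \<bar>h x * h y\<bar> * D"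
        by (rule mult_left_mono[OF dom2]) simp
      then show "norm (f n z) \<le> \<bar>h (fst z)\<bar> * \<bar>h (snd z)\<bar> * D"
        by (simp only: z f_def case_prod_conv real_norm_def abs_mult fst_conv snd_conv)
    qed
  qed measurable
  have le: "integral\<^sup>L ?LL (f n) \<le> of_nat DIM('a) * (pi * B\<^sup>2 * (l2_norm lborel h)\<^sup>2)" for n
  proof -
    let ?a = "\<lambda>r i x. h x * (r x \<bullet> i)"
    have comp: "?a r i \<in> l2 lborel UNIV" "integrable lborel (?a r i)" "l2_norm lborel (?a r i) \<le> B * l2_norm lborel h"
      if r [measurable]: "r \<in> borel_measurable borel" and rB: "\<And>x. norm (r x) \<le> B" and i: "i \<in> Basis" for r and i :: 'a
    proof -
      have le: "norm (?a r i x) \<le> norm (B * h x)" for x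
      proof -
        have "\<bar>r x \<bullet> i\<bar> \<le> B" using Basis_le_norm[OF i, of "r x"] rB[of x] by linarith
        then have "\<bar>h x\<bar> * \<bar>r x \<bullet> i\<bar> \<le> \<bar>h x\<bar> * B" by (rule mult_left_mono) simp
        then show ?thesis using B0 by (simp add: abs_mult mult.commute)
      qed
      have Bh: "(\<lambda>x. B * h x) \<in> l2 lborel UNIV"
        using l2_integrable_power2[OF h(1)] by (intro l2_I) (auto simp: power_mult_distrib abs_mult)
      show "?a r i \<in> l2 lborel UNIV" by (rule l2_dominated(1)[OF _ Bh le]) measurable
      show "integrable lborel (?a r i)"
        by (rule Bochner_Integration.integrable_bound[of _ "\<lambda>x. B * h x"]) (use h(2) le in auto)
      have "l2_norm lborel (\<lambda>x. B * h x) = B * l2_norm lborel h"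
        using B0 by (simp add: l2_norm_def' power_mult_distrib real_sqrt_mult)
      then show "l2_norm lborel (?a r i) \<le> B * l2_norm lborel h"
        using l2_dominated(2)[OF _ Bh le] by simp
    qed
    note P = comp[OF assms(3) p] and Q = comp[OF assms(4) q]
    note R = regularised_Hilbert_form[OF e0[of n] P(1,2) Q(1,2)]
    \<comment> \<open>Expanding \<open>p x \<bullet> q y\<close> in coordinates turns the form into
      \<open>DIM('a)\<close> scalar Hilbert forms, each with functions of norm at most
      \<open>B * l2_norm lborel h\<close>.\<close>
    have feq: "f n = (\<lambda>z. \<Sum>i\<in>Basis. (case z of (x, y) \<Rightarrow> ?a p i x * ?a q i y * ((x - y) / ((x - y)\<^sup>2 + (e n)\<^sup>2))))"
    proof
      fix z :: "real \<times> real"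
      obtain x y where z: "z = (x, y)" by force
      show "f n z = (\<Sum>i\<in>Basis. (case z of (x, y) \<Rightarrow> ?a p i x * ?a q i y * ((x - y) / ((x - y)\<^sup>2 + (e n)\<^sup>2))))"
        unfolding f_def z case_prod_conv euclidean_inner[of "p x" "q y"] sum_distrib_left sum_distrib_right
        by (intro sum.cong refl) (simp only: ac_simps)
    qed
    have "integral\<^sup>L ?LL (f n) = (\<Sum>i\<in>Basis. LINT z|?LL. (case z of (x, y) \<Rightarrow> ?a p i x * ?a q i y * ((x - y) / ((x - y)\<^sup>2 + (e n)\<^sup>2))))"
      unfolding feq by (rule Bochner_Integration.integral_sum) (rule R(1))
    also have "\<dots> \<le> (\<Sum>i\<in>(Basis::'a set). pi * B\<^sup>2 * (l2_norm lborel h)\<^sup>2)"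
    proof (rule sum_mono)
      fix i :: 'a assume i: "i \<in> Basis"
      have "(LINT z|?LL. (case z of (x, y) \<Rightarrow> ?a p i x * ?a q i y * ((x - y) / ((x - y)\<^sup>2 + (e n)\<^sup>2))))
        \<le> pi * l2_norm lborel (?a p i) * l2_norm lborel (?a q i)"
        using R(2)[OF i i i i] by (simp only: abs_le_iff)
      also have "\<dots> \<le> pi * (B * l2_norm lborel h) * (B * l2_norm lborel h)"
        using P(3)[OF i] Q(3)[OF i] B0 by (intro mult_mono) auto
      finally show "(LINT z|?LL. (case z of (x, y) \<Rightarrow> ?a p i x * ?a q i y * ((x - y) / ((x - y)\<^sup>2 + (e n)\<^sup>2))))
        \<le> pi * B\<^sup>2 * (l2_norm lborel h)\<^sup>2"
        by (simp add: power2_eq_square ac_simps)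
    qed
    finally show ?thesis by simp
  qed
  show "(LINT z|?LL. (case z of (x, y) \<Rightarrow> h x * h y * ((p x \<bullet> q y) / (x - y))))
      \<le> of_nat DIM('a) * (pi * B\<^sup>2 * (l2_norm lborel h)\<^sup>2)"
    by (rule LIMSEQ_le_const2[OF lim]) (use le in blast)
qed

section \<open>Positive semidefinite matrices and the matrix \<open>J\<close>\<close>

lemma inner_matrix_symmetric:
  fixes A :: "real^'m^'m"
  assumes "transpose A = A"
  shows "(A *v x) \<bullet> y = x \<bullet> (A *v y)"
  using assms by (metis dot_lmul_matrix transpose_matrix_vector)

text \<open>Symmetric Gaussian elimination, by induction on the rank: a square of one linear form is
  split off, and the remainder is again positive semidefinite, of smaller rank. The number of forms
  matters, since it becomes the bound on the dimension of \<open>K\<close>.\<close>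

lemma psd_sum_of_squares:
  fixes A :: "real^'m^'m"
  assumes "transpose A = A" "pos_semidef A"
  shows "\<exists>b :: nat \<Rightarrow> real^'m. \<forall>x y. (A *v x) \<bullet> y = (\<Sum>i<rank A. (b i \<bullet> x) * (b i \<bullet> y))"
  using assms
proof (induction "rank A" arbitrary: A rule: less_induct)
  case less
  note sym = inner_matrix_symmetric[OF less.prems(1)]
  have psd: "0 \<le> (A *v x) \<bullet> x" for x using less.prems(2) by (simp add: pos_semidef_def)
  show ?case
  proof (cases "\<forall>u. (A *v u) \<bullet> u = 0")
    case True
    have 0: "(A *v x) \<bullet> y = 0" for x y
    proof -
      \<comment> \<open>Polarisation: a symmetric matrix whose quadratic form vanishes has vanishing
        bilinear form.\<close>
      have "(A *v (x + y)) \<bullet> (x + y) = (A *v x) \<bullet> x + 2 * ((A *v x) \<bullet> y) + (A *v y) \<bullet> y"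
        using sym[of y x] by (simp add: matrix_vector_right_distrib inner_add_left inner_add_right inner_commute)
      then show ?thesis using True by simp
    qed
    show ?thesis by (rule exI[of _ "\<lambda>_. 0"]) (simp add: 0)
  next
    case False
    then obtain u where u: "(A *v u) \<bullet> u \<noteq> 0" by blast
    define w c where "w = A *v u" "c = (A *v u) \<bullet> u"
    have c: "0 < c" using u psd[of u] by (simp add: w_c_def)
    have wu: "w \<bullet> u = c" by (simp add: w_c_def)
    \<comment> \<open>the Cholesky step: \<open>A'\<close> kills \<open>u\<close> as well as the kernel of \<open>A\<close>\<close>
    define A' where "A' = A - (1 / c) *\<^sub>R (\<chi> i j. w $ i * w $ j)"
    have A'v: "A' *v x = A *v x - ((w \<bullet> x) / c) *\<^sub>R w" for x
    proof -
      have "(\<chi> i j. w $ i * w $ j) *v x = (w \<bullet> x) *\<^sub>R w"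
        by (simp add: vec_eq_iff matrix_vector_mult_def inner_vec_def sum_distrib_left sum_distrib_right ac_simps)
      then show ?thesis
        by (simp add: A'_def matrix_vector_mult_diff_rdistrib scaleR_matrix_vector_assoc[symmetric])
    qed
    have tr: "transpose A' = A'"
      using less.prems(1) by (simp add: A'_def transpose_def vec_eq_iff mult.commute)
    have wx: "w \<bullet> x = (A *v x) \<bullet> u" for x using sym[of u x] by (simp add: w_c_def inner_commute)
    have "0 \<le> (A' *v x) \<bullet> x" for x
    proof -
      let ?s = "(w \<bullet> x) / c"
      \<comment> \<open>Subtracting \<open>?s *\<^sub>R u\<close> makes the argument orthogonal to
        \<open>u\<close> for the form of \<open>A\<close>; the value of that form is then the form
        of \<open>A'\<close> at \<open>x\<close>.\<close>
      have "0 \<le> (A *v (x - ?s *\<^sub>R u)) \<bullet> (x - ?s *\<^sub>R u)" by (rule psd)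
      also have "\<dots> = (A *v x) \<bullet> x - 2 * ?s * (w \<bullet> x) + ?s * ?s * c"
        by (simp add: matrix_vector_mult_diff_distrib matrix_vector_mult_scaleR inner_diff_left inner_diff_right
            wx[symmetric] w_c_def(1)[symmetric] wu algebra_simps)
      also have "\<dots> = (A' *v x) \<bullet> x"
        using c by (simp add: A'v inner_diff_left field_simps)
      finally show ?thesis .
    qed
    then have psd': "pos_semidef A'" by (simp add: pos_semidef_def)
    have sub: "range ((*v) A') \<subset> range ((*v) A)"
    proof
      show "range ((*v) A') \<subseteq> range ((*v) A)"
      proof clarify
        fix x
        have "A' *v x = A *v (x - ((w \<bullet> x) / c) *\<^sub>R u)"
          by (simp add: A'v matrix_vector_mult_diff_distrib matrix_vector_mult_scaleR w_c_def)
        then show "A' *v x \<in> range ((*v) A)" by simp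
      qed
      \<comment> \<open>The range of \<open>A'\<close> is orthogonal to \<open>u\<close>, while
        \<open>w \<bullet> u = c\<close> is positive.\<close>
      have "w \<notin> range ((*v) A')"
      proof clarify
        fix x assume x: "w = A' *v x"
        have "(A' *v x) \<bullet> u = 0"
          using c by (simp add: A'v inner_diff_left wx[symmetric] wu)
        then show False using u x by (simp add: w_c_def)
      qed
      then show "range ((*v) A') \<noteq> range ((*v) A)" by (auto simp: w_c_def)
    qed
    have "subspace (range ((*v) A))" "subspace (range ((*v) A'))"
      using linear_subspace_image[OF matrix_vector_mul_linear subspace_UNIV] by auto
    then have r: "rank A' < rank A"
      unfolding rank_dim_range by (intro dim_psubset) (use sub in \<open>simp add: span_eq_iff[THEN iffD2]\<close>)
    obtain b where b: "(A' *v x) \<bullet> y = (\<Sum>i<rank A'. (b i \<bullet> x) * (b i \<bullet> y))" for x y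
      using less.hyps[OF r tr psd'] by blast
    \<comment> \<open>The rank is known to drop, but not by how much, so the list of forms is padded
      with zeros after index \<open>rank A'\<close>.\<close>
    define b' where "b' = (\<lambda>i. if i < rank A' then b i else if i = rank A' then (1 / sqrt c) *\<^sub>R w else 0)"
    have "(A *v x) \<bullet> y = (\<Sum>i<rank A. (b' i \<bullet> x) * (b' i \<bullet> y))" for x y
    proof -
      have "(\<Sum>i<rank A. (b' i \<bullet> x) * (b' i \<bullet> y)) = (\<Sum>i<Suc (rank A'). (b' i \<bullet> x) * (b' i \<bullet> y))"
        by (rule sum.mono_neutral_right) (use r in \<open>auto simp: b'_def\<close>)
      also have "\<dots> = (A' *v x) \<bullet> y + (w \<bullet> x) * (w \<bullet> y) / c"
        using c by (simp add: b b'_def real_sqrt_mult_self flip: times_divide_times_eq)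
      also have "\<dots> = (A *v x) \<bullet> y" by (simp add: A'v inner_diff_left)
      finally show ?thesis by simp
    qed
    then show ?thesis by blast
  qed
qed

section \<open>The matrix \<open>J_mat\<close> as an orthogonal, skew-symmetric map\<close>

lemma sum_UNIV_sum:
  fixes f :: "'n::finite + 'm::finite \<Rightarrow> real"
  shows "(\<Sum>j\<in>UNIV. f j) = (\<Sum>a\<in>UNIV. f (Inl a)) + (\<Sum>a\<in>UNIV. f (Inr a))"
  unfolding UNIV_sum by (subst sum.union_disjoint) (auto simp: sum.reindex)

lemma J_mat_vector: "J_mat *v x = (\<chi> i. case i of Inl a \<Rightarrow> - x $ Inr a | Inr a \<Rightarrow> x $ Inl a)"
  for x :: "real^('n::finite + 'n)"
  by (auto simp: vec_eq_iff matrix_vector_mult_def sum_UNIV_sum J_mat_def block_matrix_def mat_def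
      if_distrib[where f = "\<lambda>t. t * z" for z] if_distrib[of uminus] sum_negf cong: if_cong split: sum.split)

lemma J_mat_inner:
  fixes x y :: "real^('n::finite + 'n)"
  shows "(J_mat *v x) \<bullet> (J_mat *v y) = x \<bullet> y" and "(J_mat *v x) \<bullet> y = - (x \<bullet> (J_mat *v y))"
  by (simp_all add: J_mat_vector inner_vec_def sum_UNIV_sum sum_negf)

section \<open>The measure \<open>dx/x\<close>\<close>

lemma space_dx_over_x [simp]: "space dx_over_x = {1<..}"
  by (simp add: dx_over_x_def dx_measure_def space_restrict_space)

lemma sets_dx_over_x [measurable_cong]: "sets dx_over_x = sets (restrict_space borel {1<..})"
  by (simp add: dx_over_x_def dx_measure_def cong: sets_restrict_space_cong)

lemma id_measurable_dx_over_x [measurable]: "(\<lambda>x. x) \<in> borel_measurable dx_over_x"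
  unfolding measurable_cong_sets[OF sets_dx_over_x refl] by (intro measurable_restrict_space1) simp

lemma continuous_on_measurable_dx_over_x:
  fixes f :: "real \<Rightarrow> 'b::{second_countable_topology, real_normed_vector}"
  shows "continuous_on {1<..} f \<Longrightarrow> f \<in> borel_measurable dx_over_x"
  unfolding measurable_cong_sets[OF sets_dx_over_x refl]
  by (rule borel_measurable_continuous_on_restrict)

lemma measurable_dx_over_x_iff:
  fixes f :: "real \<Rightarrow> 'b::{second_countable_topology, real_normed_vector}"
  shows "f \<in> borel_measurable dx_over_x \<longleftrightarrow> (\<lambda>x. indicator {1<..} x *\<^sub>R f x) \<in> borel_measurable borel"
  unfolding measurable_cong_sets[OF sets_dx_over_x refl]
  by (subst borel_measurable_restrict_space_iff) simp_all

lemma nn_integral_dx_over_x: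
  assumes [measurable]: "f \<in> borel_measurable dx_over_x"
  shows "(\<integral>\<^sup>+x. f x \<partial>dx_over_x) = (\<integral>\<^sup>+x. ennreal (1 / x) * f x * indicator {1<..} x \<partial>lborel)"
proof -
  have m: "f \<in> borel_measurable dx_measure" using assms unfolding dx_over_x_def by simp
  have "(\<integral>\<^sup>+x. f x \<partial>dx_over_x) = (\<integral>\<^sup>+x. ennreal (1 / x) * f x \<partial>dx_measure)"
    unfolding dx_over_x_def
    by (rule nn_integral_density) (auto simp: dx_measure_def m[unfolded dx_measure_def] intro!: measurable_restrict_space1)
  then show ?thesis by (simp add: dx_measure_def nn_integral_restrict_space)
qed

lemma
  fixes f :: "real \<Rightarrow> 'b::{banach, second_countable_topology}"
  assumes f: "f \<in> borel_measurable dx_over_x"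
  shows integrable_dx_over_x_iff: "integrable dx_over_x f \<longleftrightarrow> integrable lborel (\<lambda>x. indicator {1<..} x *\<^sub>R (1 / x) *\<^sub>R f x)"
    and integral_dx_over_x: "integral\<^sup>L dx_over_x f = (LINT x|lborel. indicator {1<..} x *\<^sub>R (1 / x) *\<^sub>R f x)"
proof -
  have m: "f \<in> borel_measurable dx_measure" using f unfolding dx_over_x_def by simp
  have m1: "(\<lambda>x. 1 / x) \<in> borel_measurable dx_measure"
    unfolding dx_measure_def by (intro measurable_restrict_space1) simp
  have pos: "AE x in dx_measure. 0 \<le> 1 / x"
    by (rule AE_I2) (simp add: dx_measure_def space_restrict_space)
  show "integrable dx_over_x f \<longleftrightarrow> integrable lborel (\<lambda>x. indicator {1<..} x *\<^sub>R (1 / x) *\<^sub>R f x)"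
    unfolding dx_over_x_def integrable_density[OF m m1 pos]
    by (simp add: dx_measure_def integrable_restrict_space)
  show "integral\<^sup>L dx_over_x f = (LINT x|lborel. indicator {1<..} x *\<^sub>R (1 / x) *\<^sub>R f x)"
    unfolding dx_over_x_def integral_density[OF m m1 pos]
    by (simp add: dx_measure_def integral_restrict_space)
qed

lemma emeasure_dx_over_x_finite: "emeasure dx_over_x {1<..real n} < \<infinity>"
proof -
  have s [measurable]: "{1<..real n} \<in> sets dx_over_x"
    by (auto simp: sets_dx_over_x sets_restrict_space image_iff intro!: exI[of _ "{1<..real n}"])
  have "emeasure dx_over_x {1<..real n} = (\<integral>\<^sup>+x. indicator {1<..real n} x \<partial>dx_over_x)"
    using s by simp
  also have "\<dots> = (\<integral>\<^sup>+x. ennreal (1 / x) * indicator {1<..real n} x * indicator {1<..} x \<partial>lborel)"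
    by (rule nn_integral_dx_over_x) measurable
  also have "\<dots> \<le> (\<integral>\<^sup>+x. indicator {1<..real n} x \<partial>lborel)"
    by (intro nn_integral_mono) (auto simp: indicator_def ennreal_le_1)
  also have "\<dots> \<le> (\<integral>\<^sup>+x. indicator {0..real n} x \<partial>lborel)"
    by (intro nn_integral_mono) (auto simp: indicator_def)
  also have "\<dots> < \<infinity>" by simp
  finally show ?thesis .
qed

lemma sigma_finite_dx_over_x: "sigma_finite_measure dx_over_x"
proof
  have un: "(\<Union>n. {1<..real n}) = {1<..}" using real_arch_simple by fastforce
  have s: "{1<..real n} \<in> sets dx_over_x" for n
    by (auto simp: sets_dx_over_x sets_restrict_space image_iff intro!: exI[of _ "{1<..real n}"])
  show "\<exists>A. countable A \<and> A \<subseteq> sets dx_over_x \<and> \<Union> A = space dx_over_x \<and> (\<forall>a\<in>A. emeasure dx_over_x a \<noteq> \<infinity>)"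
    by (rule exI[of _ "range (\<lambda>n. {1<..real n})"])
      (use un s emeasure_dx_over_x_finite in \<open>auto simp: less_top\<close>)
qed

lemma mult_measurable_dx_over_x: "(\<lambda>(x, y). x * y) \<in> dx_over_x \<Otimes>\<^sub>M dx_over_x \<rightarrow>\<^sub>M dx_over_x"
proof -
  have 1: "(\<lambda>p. fst p * snd p) \<in> dx_over_x \<Otimes>\<^sub>M dx_over_x \<rightarrow>\<^sub>M restrict_space borel {1<..}"
    by (rule measurable_restrict_space2) (auto simp: space_pair_measure less_1_mult)
  then show ?thesis
    unfolding measurable_cong_sets[OF refl sets_dx_over_x] by (simp add: case_prod_beta)
qed

lemma mult_left_measurable_dx_over_x: "1 < x \<Longrightarrow> (\<lambda>y. x * y) \<in> dx_over_x \<rightarrow>\<^sub>M dx_over_x"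
  unfolding measurable_cong_sets[OF refl sets_dx_over_x]
  by (rule measurable_restrict_space2) (auto simp: less_1_mult)

text \<open>It allows kernels that agree off the diagonal to be exchanged inside an integral over
  \<open>y\<close>.\<close>

lemma AE_dx_over_x_singleton: "AE y in dx_over_x. y \<noteq> x"
proof -
  have "AE y in lborel. y \<in> {1<..} \<longrightarrow> y \<noteq> x" using AE_lborel_singleton[of x] by eventually_elim auto
  then have 1: "AE y in dx_measure. y \<noteq> x"
    unfolding dx_measure_def by (subst AE_restrict_space_iff) simp_all
  show ?thesis unfolding dx_over_x_def
    by (subst AE_density) (use 1 in \<open>auto simp: dx_measure_def intro!: measurable_restrict_space1\<close>)
qed

text \<open>The measure \<open>dy/y\<close> is invariant under dilations of the positive half-line.
  Dilation by \<open>x\<close> maps \<open>{1<..}\<close> onto \<open>{x<..}\<close>, and the loss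
  of the interval up to \<open>x\<close> gives an inequality.\<close>

lemma nn_integral_dilation_le:
  assumes f: "f \<in> borel_measurable dx_over_x" and x: "1 < x"
  shows "(\<integral>\<^sup>+y. f (x * y) \<partial>dx_over_x) \<le> (\<integral>\<^sup>+y. f y \<partial>dx_over_x)"
proof -
  \<comment> \<open>The integrand for \<open>dx/x\<close>, cut down to \<open>{x<..}\<close>. The
    function \<open>f\<close> is set to \<open>0\<close> off \<open>{1<..}\<close>, because its
    measurability is assumed on that set.\<close>
  define F where "F = (\<lambda>s. ennreal (1 / s) * (f s * indicator {1<..} s) * indicator {x<..} s)"
  have fm: "(\<lambda>s. f s * indicator {1<..} s) \<in> borel_measurable borel"
    using f unfolding measurable_cong_sets[OF sets_dx_over_x refl]
    by (subst (asm) borel_measurable_restrict_space_iff_ennreal) simp_all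
  then have Fm: "F \<in> borel_measurable borel" unfolding F_def by measurable
  have "(\<integral>\<^sup>+y. f (x * y) \<partial>dx_over_x) = (\<integral>\<^sup>+y. ennreal (1 / y) * f (x * y) * indicator {1<..} y \<partial>lborel)"
    by (rule nn_integral_dx_over_x) (rule measurable_compose[OF mult_left_measurable_dx_over_x[OF x] f])
  also have "\<dots> = (\<integral>\<^sup>+y. ennreal x * F (0 + x * y) \<partial>lborel)"
  proof (rule nn_integral_cong)
    fix y :: real
    show "ennreal (1 / y) * f (x * y) * indicator {1<..} y = ennreal x * F (0 + x * y)"
    proof (cases "1 < y")
      case True
      have "ennreal (1 / y) = ennreal x * ennreal (1 / (x * y))"
        using x True by (simp flip: ennreal_mult)
      then show ?thesis using x True by (simp add: F_def less_1_mult mult.assoc)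
    qed (use x in \<open>simp add: F_def\<close>)
  qed
  also have "\<dots> = ennreal \<bar>x\<bar> * (\<integral>\<^sup>+y. F (0 + x * y) \<partial>lborel)"
    using x Fm by (subst nn_integral_cmult) auto
  also have "\<dots> = (\<integral>\<^sup>+s. F s \<partial>lborel)"
    using x by (intro nn_integral_real_affine[symmetric] Fm) simp
  also have "\<dots> \<le> (\<integral>\<^sup>+s. ennreal (1 / s) * f s * indicator {1<..} s \<partial>lborel)"
    by (intro nn_integral_mono) (auto simp: F_def indicator_def)
  also have "\<dots> = (\<integral>\<^sup>+y. f y \<partial>dx_over_x)" by (rule nn_integral_dx_over_x[OF f, symmetric])
  finally show ?thesis .
qed

text \<open>The rows of a Hankel kernel are dilations of its symbol, so this is the uniform row
  bound that \<open>l2_kernel\<close> asks for.\<close>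

lemma l2_dilation:
  fixes \<phi> :: "real \<Rightarrow> 'b::{real_inner, banach, second_countable_topology}"
  assumes f: "\<phi> \<in> l2 dx_over_x K" and x: "1 < x"
  shows "(\<lambda>y. \<phi> (x * y)) \<in> l2 dx_over_x UNIV" "l2_norm dx_over_x (\<lambda>y. \<phi> (x * y)) \<le> l2_norm dx_over_x \<phi>"
proof -
  note m = l2_measurable[OF f]
  have m': "(\<lambda>y. \<phi> (x * y)) \<in> borel_measurable dx_over_x"
    by (rule measurable_compose[OF mult_left_measurable_dx_over_x[OF x] m])
  have "(\<integral>\<^sup>+y. ennreal ((norm (\<phi> (x * y)))\<^sup>2) \<partial>dx_over_x) \<le> (\<integral>\<^sup>+y. ennreal ((norm (\<phi> y))\<^sup>2) \<partial>dx_over_x)"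
    by (rule nn_integral_dilation_le[OF _ x]) (use m in measurable)
  also have "\<dots> = ennreal ((l2_norm dx_over_x \<phi>)\<^sup>2)"
    unfolding l2_norm_power2 by (intro nn_integral_eq_integral l2_integrable_power2[OF f]) simp
  finally have *: "(\<integral>\<^sup>+y. ennreal ((norm (\<phi> (x * y)))\<^sup>2) \<partial>dx_over_x) \<le> ennreal ((l2_norm dx_over_x \<phi>)\<^sup>2)" .
  show l: "(\<lambda>y. \<phi> (x * y)) \<in> l2 dx_over_x UNIV"
    by (rule l2_I[OF m'], rule integrableI_bounded) (use m' le_less_trans[OF *] in auto)
  have "ennreal ((l2_norm dx_over_x (\<lambda>y. \<phi> (x * y)))\<^sup>2) \<le> ennreal ((l2_norm dx_over_x \<phi>)\<^sup>2)"
    using * unfolding l2_norm_power2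
    by (subst (asm) nn_integral_eq_integral[OF l2_integrable_power2[OF l]]) simp_all
  then show "l2_norm dx_over_x (\<lambda>y. \<phi> (x * y)) \<le> l2_norm dx_over_x \<phi>"
    by (intro power2_le_imp_le[OF _ l2_norm_nonneg]) simp
qed

section \<open>Behaviour at infinity of integrable functions\<close>

lemma emeasure_lborel_Ici: "emeasure lborel {T::real..} = \<infinity>"
proof (rule ccontr)
  assume "emeasure lborel {T..} \<noteq> \<infinity>"
  then have fin: "emeasure lborel {T..} < \<infinity>" by (simp add: less_top)
  have "ennreal (real n) \<le> emeasure lborel {T..}" for n
  proof -
    have "emeasure lborel {T..T + real n} \<le> emeasure lborel {T..}" by (intro emeasure_mono) auto
    then show ?thesis by simp
  qed
  moreover obtain r where "emeasure lborel {T..} = ennreal r" "0 \<le> r"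
    using fin by (metis ennreal_cases less_irrefl infinity_ennreal_def)
  moreover obtain n where "r < real n" using reals_Archimedean2 by blast
  ultimately show False by (metis ennreal_less_iff not_less)
qed

text \<open>With a nonzero limit, the absolute value of \<open>f\<close> would exceed half that of
  \<open>L\<close> on a half-line of infinite measure. Existence of the limit is assumed since
  integrability alone does not imply it.\<close>

lemma integrable_tendsto_at_top_zero:
  fixes f :: "real \<Rightarrow> real"
  assumes int: "set_integrable lborel {a..} f" and lim: "(f \<longlongrightarrow> L) at_top"
  shows "L = 0"
proof (rule ccontr)
  assume L: "L \<noteq> 0"
  have "\<forall>\<^sub>F x in at_top. dist (f x) L < \<bar>L\<bar> / 2" using tendstoD[OF lim, of "\<bar>L\<bar> / 2"] L by simp
  then obtain T where T: "dist (f x) L < \<bar>L\<bar> / 2" if "T \<le> x" for x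
    unfolding eventually_at_top_linorder by blast
  let ?T = "max a T"
  have "integrable lborel (\<lambda>x. indicator {?T..} x * (\<bar>L\<bar> / 2))"
  proof (rule Bochner_Integration.integrable_bound[OF int[unfolded set_integrable_def]])
    have "norm (indicator {?T..} x * (\<bar>L\<bar> / 2)) \<le> norm (indicator {a..} x *\<^sub>R f x)" for x
      using T[of x] abs_triangle_ineq4[of "f x" "f x - L"] by (auto simp: indicator_def dist_real_def)
    then show "AE x in lborel. norm (indicator {?T..} x * (\<bar>L\<bar> / 2)) \<le> norm (indicator {a..} x *\<^sub>R f x)"
      by simp
  qed measurable
  then have "integrable lborel (\<lambda>x. indicator {?T..} x * (\<bar>L\<bar> / 2) * (2 / \<bar>L\<bar>))"
    by (rule integrable_mult_left)
  then have "integrable lborel (indicator {?T..} :: real \<Rightarrow> real)" using L by (simp cong: integrable_cong)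
  then have "emeasure lborel {?T..} < \<infinity>" by (simp add: integrable_indicator_iff)
  then show False by (simp add: emeasure_lborel_Ici)
qed

section \<open>The integral representation of the kernel\<close>

text \<open>
  The left-hand side of \<open>key\<close> is, up to the factor \<open>x - y\<close>, the derivative of the kernel \<open>w\<close> below
  along dilations \<open>(t x, t y)\<close>.
\<close>

locale hankel_system =
  fixes u u' :: "real \<Rightarrow> 'a::euclidean_space" and J :: "'a \<Rightarrow> 'a"
    and c :: "nat \<Rightarrow> real \<Rightarrow> real" and r :: nat and B L :: real
  assumes deriv: "\<And>x. 1 < x \<Longrightarrow> (u has_vector_derivative u' x) (at x)"
    and J_linear: "linear J" and J_norm: "\<And>p. norm (J p) = norm p" and J_skew: "\<And>p. J p \<bullet> p = 0"
    and u_bound: "\<And>x. 1 < x \<Longrightarrow> norm (u x) \<le> B" and u'_bound: "\<And>x. 1 < x \<Longrightarrow> norm (u' x) \<le> L"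
    and u_l2: "u \<in> l2 dx_measure UNIV"
    and c_cont: "\<And>i. continuous_on {1<..} (c i)" and c_l2: "\<And>i. c i \<in> l2 dx_over_x UNIV"
    and key: "\<And>x y. 1 < x \<Longrightarrow> 1 < y \<Longrightarrow>
      sqrt (x * y) * (J (x *\<^sub>R u' x) \<bullet> u y + J (u x) \<bullet> (y *\<^sub>R u' y)) = (y - x) * (\<Sum>i<r. c i x * c i y)"
begin

definition w :: "real \<Rightarrow> real \<Rightarrow> real" where
  "w x y = sqrt (x * y) / (x - y) * (J (u x) \<bullet> u y)"

lemma u_cont: "continuous_on {1<..} u"
  using deriv by (intro continuous_at_imp_continuous_on ballI)
    (auto intro: has_vector_derivative_continuous)

lemma J_bounded_linear: "bounded_linear J"
  using J_linear by (simp add: linear_conv_bounded_linear)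

lemma u_measurable [measurable]: "u \<in> borel_measurable dx_over_x"
  by (rule continuous_on_measurable_dx_over_x[OF u_cont])

lemma Ju_measurable [measurable]: "(\<lambda>x. J (u x)) \<in> borel_measurable dx_over_x"
  by (rule continuous_on_measurable_dx_over_x)
    (rule bounded_linear.continuous_on[OF J_bounded_linear u_cont])

lemma w_measurable [measurable]: "case_prod w \<in> borel_measurable (dx_over_x \<Otimes>\<^sub>M dx_over_x)"
  unfolding w_def by measurable

lemma u_dilated_integrable:
  assumes x: "1 < x"
  shows "set_integrable lborel {1..} (\<lambda>t. (norm (u (x * t)))\<^sup>2)"
proof -
  have "integrable lborel (\<lambda>s. indicator {1<..} s *\<^sub>R (norm (u s))\<^sup>2)"
    using u_l2 by (simp add: l2_def dx_measure_def integrable_restrict_space)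
  then have "integrable lborel (\<lambda>t. indicator {1<..} (0 + x * t) *\<^sub>R (norm (u (0 + x * t)))\<^sup>2)"
    by (rule lborel_integrable_real_affine) (use x in simp)
  then have "integrable lborel (\<lambda>t. indicator {1..} t *\<^sub>R (indicator {1<..} (0 + x * t) *\<^sub>R (norm (u (0 + x * t)))\<^sup>2))"
    by (intro integrable_mult_indicator) simp_all
  moreover have "indicator {1..} t *\<^sub>R (indicator {1<..} (0 + x * t) *\<^sub>R (norm (u (0 + x * t)))\<^sup>2)
      = indicator {1..} t *\<^sub>R (norm (u (x * t)))\<^sup>2" for t
  proof (cases "1 \<le> t")
    case True
    then have "1 < x * t" using x by (metis less_le_trans mult.right_neutral mult_left_mono less_imp_le zero_less_one order.strict_trans)
    then show ?thesis by simp
  qed simp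
  ultimately show ?thesis unfolding set_integrable_def by (simp only:)
qed

text \<open>The function \<open>F\<close> is \<open>w\<close> along the dilations
  \<open>(x * t, y * t)\<close>, and \<open>key\<close> says that its derivative is
  \<open>- G\<close>. Hence \<open>F\<close> has a limit at infinity, equal to \<open>F 1\<close>
  minus the integral of \<open>G\<close>. Since \<open>F\<close> is integrable for
  \<open>dt\<close>, this limit is \<open>0\<close>.\<close>

lemma w_representation:
  assumes x: "1 < x" and y: "1 < y" and xy: "x \<noteq> y"
  shows "w x y = (LINT t|dx_over_x. (\<Sum>i<r. c i (t * x) * c i (t * y)))"
proof -
  define F where "F = (\<lambda>t. sqrt (x * y) / (x - y) * (J (u (x * t)) \<bullet> u (y * t)))"
  define G where "G = (\<lambda>t. (\<Sum>i<r. c i (t * x) * c i (t * y)) / t)"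
  have big: "1 < x * t" "1 < y * t" if "1 \<le> t" for t
    using x y that mult_left_mono[OF that, of x] mult_left_mono[OF that, of y] by linarith+
  have F': "(F has_vector_derivative - G t) (at t within {1..T})" if t: "1 \<le> t" for t T
  proof -
    have du: "((\<lambda>t. u (z * t)) has_vector_derivative z *\<^sub>R u' (z * t)) (at t)" if "1 < z * t" for z
    proof -
      have "((\<lambda>t. z * t) has_vector_derivative z) (at t)"
        by (auto intro!: derivative_eq_intros simp flip: has_real_derivative_iff_has_vector_derivative)
      from vector_diff_chain_at[OF this deriv[OF that]] show ?thesis by (simp add: o_def)
    qed
    have dJ: "((\<lambda>t. J (u (x * t))) has_vector_derivative J (x *\<^sub>R u' (x * t))) (at t)"
      by (rule bounded_linear.has_vector_derivative[OF J_bounded_linear du[OF big(1)[OF t]]])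
    have "((\<lambda>t. J (u (x * t)) \<bullet> u (y * t)) has_vector_derivative
        (J (u (x * t)) \<bullet> (y *\<^sub>R u' (y * t)) + J (x *\<^sub>R u' (x * t)) \<bullet> u (y * t))) (at t)"
      by (rule bounded_bilinear.has_vector_derivative[OF bounded_bilinear_inner dJ du[OF big(2)[OF t]]])
    then have "(F has_vector_derivative sqrt (x * y) / (x - y) *
        (J (u (x * t)) \<bullet> (y *\<^sub>R u' (y * t)) + J (x *\<^sub>R u' (x * t)) \<bullet> u (y * t))) (at t)"
      unfolding F_def by (rule has_vector_derivative_mult_right)
    moreover have "sqrt (x * y) / (x - y) *
        (J (u (x * t)) \<bullet> (y *\<^sub>R u' (y * t)) + J (x *\<^sub>R u' (x * t)) \<bullet> u (y * t)) = - G t"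
    proof -
      have J_scale: "J (s *\<^sub>R p) = s *\<^sub>R J p" for s p using J_linear by (rule linear_scale)
      have t2: "sqrt ((x * t) * (y * t)) = t * sqrt (x * y)"
      proof -
        have "(x * t) * (y * t) = (x * y) * t\<^sup>2" by (simp add: power2_eq_square)
        then show ?thesis using t by (simp add: real_sqrt_mult)
      qed
      define a b where "a = J (u' (x * t)) \<bullet> u (y * t)" "b = J (u (x * t)) \<bullet> u' (y * t)"
      define s where "s = (\<Sum>i<r. c i (x * t) * c i (y * t))"
      \<comment> \<open>In \<open>key\<close> at \<open>(x * t, y * t)\<close> the left side carries
        two powers of \<open>t\<close>, from the square root and from the scaled derivatives, and
        the right side carries one. The surplus power is the \<open>1 / t\<close> in
        \<open>G\<close>.\<close>
      have "(t * sqrt (x * y)) * (t * (x * a + y * b)) = (t * (y - x)) * s"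
        using key[OF big[OF t]] unfolding t2 a_b_def s_def by (simp add: J_scale algebra_simps)
      then have "t * (t * (sqrt (x * y) * (x * a + y * b))) = t * ((y - x) * s)"
        by (simp only: ac_simps)
      then have "t * (sqrt (x * y) * (x * a + y * b)) = (y - x) * s"
        using t by simp
      then have "sqrt (x * y) * (y * b + x * a) = - (s / t) * (x - y)"
        using t by (simp add: field_simps)
      then have "sqrt (x * y) / (x - y) * (y * b + x * a) = - (s / t)"
        using xy by (simp add: divide_eq_eq)
      then show ?thesis by (simp add: G_def s_def a_b_def J_scale mult.commute[of t])
    qed
    ultimately show ?thesis by (auto intro: has_vector_derivative_at_within)
  qed
  have Gcont: "continuous_on {1..} G"
    unfolding G_def
    by (intro continuous_intros continuous_on_compose2[OF c_cont]) (use big in \<open>auto simp: mult.commute\<close>)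
  have Fcont: "continuous_on {1..} F"
    unfolding F_def
    by (intro continuous_intros bounded_linear.continuous_on[OF J_bounded_linear] continuous_on_compose2[OF u_cont])
      (use big in auto)
  have cx: "(\<lambda>t. c i (t * z)) \<in> l2 dx_over_x UNIV" if "1 < z" for i z
    using l2_dilation(1)[OF c_l2 that, of i] by (simp add: mult.commute)
  have int_s: "integrable dx_over_x (\<lambda>t. \<Sum>i<r. c i (t * x) * c i (t * y))"
    using l2_inner_integrable[OF cx[OF x] cx[OF y]] by (intro Bochner_Integration.integrable_sum) simp
  have m_s: "(\<lambda>t. \<Sum>i<r. c i (t * x) * c i (t * y)) \<in> borel_measurable dx_over_x"
    using int_s by auto
  have G1: "integrable lborel (\<lambda>t. indicator {1<..} t *\<^sub>R G t)"
    and G2: "(LINT t|dx_over_x. (\<Sum>i<r. c i (t * x) * c i (t * y))) = (LINT t|lborel. indicator {1<..} t *\<^sub>R G t)"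
    using int_s integrable_dx_over_x_iff[OF m_s] integral_dx_over_x[OF m_s] by (simp_all add: G_def)
  \<comment> \<open>The measure \<open>dx_over_x\<close> lives on the open half-line, the
    fundamental theorem is used on closed intervals; the endpoint \<open>1\<close> is a null
    set.\<close>
  have AE1: "AE t in lborel. indicator {1..} t *\<^sub>R G t = indicator {1<..} t *\<^sub>R G t"
    using AE_lborel_singleton[of 1] by eventually_elim (auto simp: indicator_def)
  have Gm: "(\<lambda>t. indicator {1..} t *\<^sub>R G t) \<in> borel_measurable lborel"
    using borel_measurable_continuous_on_indicator[OF _ Gcont] by simp
  have Gint: "set_integrable lborel {1..} G"
    unfolding set_integrable_def using integrable_cong_AE[OF Gm _ AE1] G1 by auto
  have Gval: "(LINT t:{1..}|lborel. G t) = (LINT t|lborel. indicator {1<..} t *\<^sub>R G t)"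
    unfolding set_lebesgue_integral_def using G1 by (intro integral_cong_AE Gm AE1) auto
  have FTC: "(LINT t:{1..T}|lborel. G t) = F 1 - F T" if "1 \<le> T" for T
  proof -
    have "(LINT t|lborel. indicator {1..T} t *\<^sub>R (- G t)) = F T - F 1"
      by (rule integral_FTC_atLeastAtMost[OF that F']) (auto intro!: continuous_on_minus continuous_on_subset[OF Gcont])
    then show ?thesis by (simp add: set_lebesgue_integral_def)
  qed
  have limG: "((\<lambda>T. LINT t:{1..T}|lborel. G t) \<longlongrightarrow> (LINT t:{1..}|lborel. G t)) at_top"
    by (rule tendsto_set_lebesgue_integral_at_top[OF _ Gint]) simp
  have "((\<lambda>T. F 1 - (LINT t:{1..T}|lborel. G t)) \<longlongrightarrow> F 1 - (LINT t:{1..}|lborel. G t)) at_top"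
    by (intro tendsto_diff tendsto_const limG)
  then have limF: "(F \<longlongrightarrow> F 1 - (LINT t:{1..}|lborel. G t)) at_top"
    by (rule Lim_transform_eventually) (auto simp: FTC eventually_at_top_linorder intro!: exI[of _ 1])
  \<comment> \<open>For fixed \<open>x\<close> and \<open>y\<close> the function \<open>F\<close> is
    bounded by a multiple of the squared norms of the two dilates of \<open>u\<close>, integrable
    because \<open>u\<close> is square integrable for \<open>dx\<close>.\<close>
  have Fint: "set_integrable lborel {1..} F"
    unfolding set_integrable_def
  proof (rule Bochner_Integration.integrable_bound)
    let ?k = "\<bar>sqrt (x * y) / (x - y)\<bar>"
    have "integrable lborel (\<lambda>t. ?k * (indicator {1..} t *\<^sub>R (norm (u (x * t)))\<^sup>2 + indicator {1..} t *\<^sub>R (norm (u (y * t)))\<^sup>2))"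
      using u_dilated_integrable[OF x] u_dilated_integrable[OF y] unfolding set_integrable_def
      by (intro integrable_mult_right Bochner_Integration.integrable_add)
    then show "integrable lborel (\<lambda>t. ?k * (indicator {1..} t *\<^sub>R ((norm (u (x * t)))\<^sup>2 + (norm (u (y * t)))\<^sup>2)))"
      by (simp add: algebra_simps)
    show "(\<lambda>t. indicator {1..} t *\<^sub>R F t) \<in> borel_measurable lborel"
      using borel_measurable_continuous_on_indicator[OF _ Fcont] by simp
    show "AE t in lborel. norm (indicator {1..} t *\<^sub>R F t)
        \<le> norm (?k * (indicator {1..} t *\<^sub>R ((norm (u (x * t)))\<^sup>2 + (norm (u (y * t)))\<^sup>2)))"
    proof (rule AE_I2)
      fix t
      have "\<bar>J (u (x * t)) \<bullet> u (y * t)\<bar> \<le> norm (u (x * t)) * norm (u (y * t))"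
        using Cauchy_Schwarz_ineq2[of "J (u (x * t))" "u (y * t)"] by (simp add: J_norm)
      also have "\<dots> \<le> (norm (u (x * t)))\<^sup>2 + (norm (u (y * t)))\<^sup>2"
        using sum_squares_bound[of "norm (u (x * t))" "norm (u (y * t))"]
          mult_nonneg_nonneg[OF norm_ge_zero[of "u (x * t)"] norm_ge_zero[of "u (y * t)"]] by linarith
      finally have "?k * \<bar>J (u (x * t)) \<bullet> u (y * t)\<bar> \<le> ?k * ((norm (u (x * t)))\<^sup>2 + (norm (u (y * t)))\<^sup>2)"
        by (rule mult_left_mono) simp
      then have "norm (F t) \<le> norm (?k * ((norm (u (x * t)))\<^sup>2 + (norm (u (y * t)))\<^sup>2))"
        by (simp add: F_def abs_mult)
      then show "norm (indicator {1..} t *\<^sub>R F t)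
        \<le> norm (?k * (indicator {1..} t *\<^sub>R ((norm (u (x * t)))\<^sup>2 + (norm (u (y * t)))\<^sup>2)))"
        by (cases "1 \<le> t") simp_all
    qed
  qed
  have "F 1 - (LINT t:{1..}|lborel. G t) = 0"
    by (rule integrable_tendsto_at_top_zero[OF Fint limF])
  then show ?thesis using G2 Gval by (simp add: F_def w_def)
qed

section \<open>Boundedness of the quadratic form of \<open>w\<close>\<close>

lemma u_Lipschitz:
  assumes "1 < x" "1 < y"
  shows "norm (u x - u y) \<le> L * norm (x - y)"
proof (rule differentiable_bound[of "{1<..}"])
  show "(u has_derivative (\<lambda>h. h *\<^sub>R u' z)) (at z within {1<..})" if "z \<in> {1<..}" for z
    using deriv[of z] that by (auto simp: has_vector_derivative_def intro: has_derivative_at_withinI)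
  show "onorm (\<lambda>h. h *\<^sub>R u' z) \<le> L" if "z \<in> {1<..}" for z
    by (rule onorm_le) (use u'_bound[of z] that in \<open>simp add: mult.commute[of L] mult_left_mono\<close>)
qed (use assms in auto)

text \<open>As \<open>J (u x) \<bullet> u x = 0\<close>, the second factor may be replaced by
  \<open>u y - u x\<close>. This gives the constant \<open>D\<close> needed in
  \<open>Hilbert_commutator_form\<close>.\<close>

lemma Ju_u_bound:
  assumes "1 < x" "1 < y"
  shows "\<bar>J (u x) \<bullet> u y\<bar> \<le> B * L * \<bar>x - y\<bar>"
proof -
  have "J (u x) \<bullet> u y = J (u x) \<bullet> (u y - u x)" by (simp add: inner_diff_right J_skew)
  also have "\<bar>\<dots>\<bar> \<le> norm (u x) * norm (u y - u x)"
    using Cauchy_Schwarz_ineq2[of "J (u x)" "u y - u x"] by (simp add: J_norm)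
  also have "\<dots> \<le> B * (L * \<bar>y - x\<bar>)"
    using u_bound[OF assms(1)] u_Lipschitz[OF assms(2,1)]
    by (intro mult_mono) (auto intro: order_trans[OF norm_ge_zero])
  finally show ?thesis by (simp add: abs_minus_commute mult.assoc)
qed

text \<open>Passing from \<open>dx/x\<close> to \<open>dx\<close> with \<open>h = g / sqrt x\<close>
  preserves the \<open>l2\<close> norm, and the weights absorb the factor
  \<open>sqrt (x * y)\<close> of \<open>w\<close>, leaving the Hilbert form of
  \<open>J (u x)\<close> and \<open>u y\<close>. The kernel \<kappa> stands for the Gram kernel,
  which is known to equal \<open>w\<close> off the diagonal.\<close>

lemma w_form_bound:
  assumes g: "g \<in> l2 dx_over_x UNIV" and supp: "\<And>x. x \<notin> {1<..real n} \<Longrightarrow> g x = 0"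
    and \<kappa> [measurable]: "case_prod \<kappa> \<in> borel_measurable (dx_over_x \<Otimes>\<^sub>M dx_over_x)"
    and eq: "\<And>x y. 1 < x \<Longrightarrow> 1 < y \<Longrightarrow> x \<noteq> y \<Longrightarrow> \<kappa> x y = w x y"
    and int: "integrable (dx_over_x \<Otimes>\<^sub>M dx_over_x) (\<lambda>(x, y). g x * g y * \<kappa> x y)"
  shows "(LINT p|(dx_over_x \<Otimes>\<^sub>M dx_over_x). (case p of (x, y) \<Rightarrow> g x * g y * \<kappa> x y))
    \<le> of_nat DIM('a) * (pi * B\<^sup>2 * (l2_norm dx_over_x g)\<^sup>2)"
proof -
  interpret M: sigma_finite_measure dx_over_x by (rule sigma_finite_dx_over_x)
  interpret MM: pair_sigma_finite dx_over_x dx_over_x ..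
  have gm [measurable]: "g \<in> borel_measurable dx_over_x" using g by (rule l2_measurable)
  define h where "h = (\<lambda>x. indicator {1<..} x *\<^sub>R (g x / sqrt x))"
  define p q where "p = (\<lambda>x. indicator {1<..} x *\<^sub>R J (u x))" "q = (\<lambda>x. indicator {1<..} x *\<^sub>R u x)"
  have B0: "0 \<le> B" using u_bound[of 2] by (auto intro: order_trans[OF norm_ge_zero])
  have L0: "0 \<le> L" using u'_bound[of 2] by (auto intro: order_trans[OF norm_ge_zero])
  have [measurable]: "p \<in> borel_measurable borel" "q \<in> borel_measurable borel"
    unfolding p_q_def using measurable_dx_over_x_iff[THEN iffD1, OF Ju_measurable]
      measurable_dx_over_x_iff[THEN iffD1, OF u_measurable] by simp_all
  have "(\<lambda>x. g x / sqrt x) \<in> borel_measurable dx_over_x" by measurable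
  then have hm [measurable]: "h \<in> borel_measurable borel"
    unfolding h_def measurable_dx_over_x_iff .
  have sq: "(\<lambda>x. (norm (g x))\<^sup>2) \<in> borel_measurable dx_over_x" by measurable
  have h2: "(norm (h x))\<^sup>2 = indicator {1<..} x *\<^sub>R (1 / x) *\<^sub>R (norm (g x))\<^sup>2" for x
    by (cases "1 < x") (simp_all add: h_def power_divide)
  have hl2: "h \<in> l2 lborel UNIV"
    by (rule l2_I) (use l2_integrable_power2[OF g] integrable_dx_over_x_iff[OF sq] h2 in simp_all)
  have hn: "l2_norm lborel h = l2_norm dx_over_x g"
    unfolding l2_norm_def' h2 integral_dx_over_x[OF sq] ..
  \<comment> \<open>The density \<open>1 / x\<close> is bounded on the support of \<open>g\<close>,
    and that support lies in an interval of finite length.\<close>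
  have hint: "integrable lborel h"
    by (rule l2_integrable_finite_support[OF hl2, of "{0..real n}"]) (auto simp: h_def indicator_def supp)
  have pB: "norm (p x) \<le> B" and qB: "norm (q x) \<le> B" for x
    using u_bound[of x] B0 by (auto simp: p_q_def J_norm indicator_def)
  have pq: "\<bar>p x \<bullet> q y\<bar> \<le> B * L * \<bar>x - y\<bar>" for x y
    using Ju_u_bound[of x y] B0 L0 by (auto simp: p_q_def indicator_def)
  have H1: "integrable (lborel \<Otimes>\<^sub>M lborel) (\<lambda>(x, y). h x * h y * ((p x \<bullet> q y) / (x - y)))"
    and H2: "(LINT z|(lborel \<Otimes>\<^sub>M lborel). (case z of (x, y) \<Rightarrow> h x * h y * ((p x \<bullet> q y) / (x - y))))
      \<le> of_nat DIM('a) * (pi * B\<^sup>2 * (l2_norm lborel h)\<^sup>2)"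
    by (rule Hilbert_commutator_form[OF hl2 hint _ _ pB qB pq]; measurable)+
  have pt: "(1 / x) * ((1 / y) * (g x * g y * w x y)) = h x * h y * ((p x \<bullet> q y) / (x - y))"
    if "1 < x" "1 < y" for x y
  proof -
    have s: "sqrt z / z = 1 / sqrt z" if "1 < z" for z
      using that by (simp add: field_simps)
    have "(1 / x) * ((1 / y) * (g x * g y * w x y)) = g x * g y * (sqrt x / x) * (sqrt y / y) * ((J (u x) \<bullet> u y) / (x - y))"
      by (simp add: w_def real_sqrt_mult)
    then show ?thesis using that by (simp add: s h_def p_q_def)
  qed
  have z: "h x * h y * ((p x \<bullet> q y) / (x - y)) = 0" if "\<not> 1 < x \<or> \<not> 1 < y" for x y
    using that by (auto simp: h_def)
  \<comment> \<open>For each \<open>x\<close> the two integrands can differ at the single point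
    \<open>y = x\<close> only.\<close>
  have inner: "(LINT y|dx_over_x. g x * g y * \<kappa> x y) = (LINT y|dx_over_x. g x * g y * w x y)" if x: "1 < x" for x
  proof (rule integral_cong_AE)
    have xs: "x \<in> space dx_over_x" using x by simp
    have "\<kappa> x \<in> borel_measurable dx_over_x" using measurable_Pair2[OF \<kappa> xs] by simp
    then show "(\<lambda>y. g x * g y * \<kappa> x y) \<in> borel_measurable dx_over_x" by measurable
    have "w x \<in> borel_measurable dx_over_x" using measurable_Pair2[OF w_measurable xs] by simp
    then show "(\<lambda>y. g x * g y * w x y) \<in> borel_measurable dx_over_x" by measurable
    show "AE y in dx_over_x. g x * g y * \<kappa> x y = g x * g y * w x y"
      using AE_dx_over_x_singleton[of x] AE_space by eventually_elim (use x eq in auto)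
  qed
  have "(LINT p|(dx_over_x \<Otimes>\<^sub>M dx_over_x). (case p of (x, y) \<Rightarrow> g x * g y * \<kappa> x y))
    = (LINT x|dx_over_x. LINT y|dx_over_x. g x * g y * \<kappa> x y)"
    using MM.integral_fst[OF int] by simp
  also have "\<dots> = (LINT x|dx_over_x. LINT y|dx_over_x. g x * g y * w x y)"
    by (intro Bochner_Integration.integral_cong refl inner) simp
  also have "\<dots> = (LINT x|lborel. indicator {1<..} x *\<^sub>R (1 / x) *\<^sub>R (LINT y|dx_over_x. g x * g y * w x y))"
    by (rule integral_dx_over_x, rule M.borel_measurable_lebesgue_integral) measurable
  also have "\<dots> = (LINT x|lborel. LINT y|lborel. h x * h y * ((p x \<bullet> q y) / (x - y)))"
  proof (intro Bochner_Integration.integral_cong refl)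
    fix x :: real
    show "indicator {1<..} x *\<^sub>R (1 / x) *\<^sub>R (LINT y|dx_over_x. g x * g y * w x y)
      = (LINT y|lborel. h x * h y * ((p x \<bullet> q y) / (x - y)))"
    proof (cases "1 < x")
      case True
      then have "w x \<in> borel_measurable dx_over_x" using measurable_Pair2[OF w_measurable, of x] by simp
      then have m: "(\<lambda>y. g x * g y * w x y) \<in> borel_measurable dx_over_x" by measurable
      have "indicator {1<..} x *\<^sub>R (1 / x) *\<^sub>R (LINT y|dx_over_x. g x * g y * w x y)
        = (LINT y|lborel. (1 / x) * (indicator {1<..} y *\<^sub>R (1 / y) *\<^sub>R (g x * g y * w x y)))"
        unfolding integral_dx_over_x[OF m] integral_mult_right_zero using True by simp
      also have "\<dots> = (LINT y|lborel. h x * h y * ((p x \<bullet> q y) / (x - y)))"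
      proof (intro Bochner_Integration.integral_cong refl)
        fix y :: real
        show "(1 / x) * (indicator {1<..} y *\<^sub>R (1 / y) *\<^sub>R (g x * g y * w x y)) = h x * h y * ((p x \<bullet> q y) / (x - y))"
          using pt[OF True, of y] z[of x y] by (cases "1 < y") simp_all
      qed
      finally show ?thesis .
    qed (simp add: h_def)
  qed
  also have "\<dots> = (LINT z|(lborel \<Otimes>\<^sub>M lborel). (case z of (x, y) \<Rightarrow> h x * h y * ((p x \<bullet> q y) / (x - y))))"
    using lborel_pair.integral_fst[OF H1] by simp
  also have "\<dots> \<le> of_nat DIM('a) * (pi * B\<^sup>2 * (l2_norm dx_over_x g)\<^sup>2)"
    using H2 by (simp add: hn)
  finally show ?thesis .
qed

text \<open>The target space is left open so that it can be taken large in the general case and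
  equal to \<open>real\<close> when \<open>r = 1\<close>. The adjoint is given as an explicit
  integral rather than by existence, because in the scalar case it has to be recognised as a Hankel
  operator.\<close>

lemma factorisation:
  assumes r: "r \<le> DIM('b::euclidean_space)"
  shows "maps_l2 dx_over_x UNIV w \<and> (\<exists>(K :: 'b set) \<phi>. subspace K \<and> dim K \<le> r \<and> \<phi> \<in> l2 dx_over_x K \<and>
      maps_l2 dx_over_x K (hankel_kernel \<phi>) \<and>
      l2_continuous dx_over_x (hankel_op \<phi>) \<and>
      is_l2_adjoint dx_over_x K (hankel_op \<phi>) (\<lambda>h x. LINT t|dx_over_x. \<phi> (x * t) \<bullet> h t) \<and>
      l2_op_eq dx_over_x (integral_op dx_over_x w) ((\<lambda>h x. LINT t|dx_over_x. \<phi> (x * t) \<bullet> h t) \<circ> hankel_op \<phi>))"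
proof -
  \<comment> \<open>The functions \<open>c i\<close> become the coordinates of \<phi> along
    \<open>r\<close> orthonormal vectors, so that \<open>\<phi> x \<bullet> \<phi> y\<close> is the
    sum in \<open>key\<close>, and the span of these vectors is \<open>K\<close>.\<close>
  obtain D :: "'b set" where D: "D \<subseteq> Basis" "card D = r"
    using r by (metis obtain_subset_with_card_n)
  then have fD: "finite D" using finite_Basis finite_subset by blast
  obtain e where e: "bij_betw e {..<r} D"
    using ex_bij_betw_nat_finite[OF fD] D(2) by (auto simp: atLeast0LessThan)
  have eB: "e i \<in> Basis" if "i < r" for i using e D(1) that by (auto simp: bij_betw_def)
  have ee: "e i \<bullet> e j = (if i = j then 1 else 0)" if "i < r" "j < r" for i j
    using inner_Basis[OF eB eB, OF that] e that by (auto simp: bij_betw_def inj_on_def)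
  define \<phi> where "\<phi> = (\<lambda>x. \<Sum>i<r. c i x *\<^sub>R e i)"
  define K where "K = span D"
  have \<phi>K: "\<phi> x \<in> K" for x
    unfolding \<phi>_def K_def using e by (intro span_sum span_scale span_base) (auto simp: bij_betw_def)
  have K: "subspace K" "dim K \<le> r"
    unfolding K_def using dim_le_card[OF order_refl fD] D(2) by auto
  have ip: "\<phi> x \<bullet> \<phi> y = (\<Sum>i<r. c i x * c i y)" for x y
  proof -
    have "\<phi> x \<bullet> \<phi> y = (\<Sum>i<r. \<Sum>j<r. c i x * (c j y * (e i \<bullet> e j)))"
      unfolding \<phi>_def by (subst inner_sum_left, subst inner_sum_right) (simp add: mult.left_commute)
    also have "\<dots> = (\<Sum>i<r. \<Sum>j<r. if i = j then c i x * c j y else 0)"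
      by (intro sum.cong refl) (simp add: ee)
    finally show ?thesis by simp
  qed
  have \<phi>m [measurable]: "\<phi> \<in> borel_measurable dx_over_x"
    unfolding \<phi>_def using l2_measurable[OF c_l2] by measurable
  have \<phi>l2: "\<phi> \<in> l2 dx_over_x UNIV"
  proof (rule l2_I[OF \<phi>m])
    show "integrable dx_over_x (\<lambda>x. (norm (\<phi> x))\<^sup>2)"
      unfolding power2_norm_eq_inner ip using l2_inner_integrable[OF c_l2 c_l2]
      by (intro Bochner_Integration.integrable_sum) simp
  qed
  have B0: "0 \<le> B" using u_bound[of 2] by (auto intro: order_trans[OF norm_ge_zero])
  \<comment> \<open>On the diagonal \<open>\<kappa>\<close> has the value of the Gram integral,
    while \<open>w\<close> is \<open>0\<close> there by division by zero; the two are identified off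
    the diagonal.\<close>
  define \<kappa> where "\<kappa> = (\<lambda>x y. LINT t|dx_over_x. hankel_kernel \<phi> t x \<bullet> hankel_kernel \<phi> t y)"
  have \<kappa>w: "\<kappa> x y = w x y" if "1 < x" "1 < y" "x \<noteq> y" for x y
    unfolding \<kappa>_def hankel_kernel_def ip by (rule w_representation[OF that, symmetric])
  have meas [measurable]: "case_prod (hankel_kernel \<phi>) \<in> borel_measurable (dx_over_x \<Otimes>\<^sub>M dx_over_x)"
  proof -
    have "case_prod (hankel_kernel \<phi>) = (\<lambda>p. \<phi> (case p of (x, y) \<Rightarrow> x * y))"
      by (auto simp: fun_eq_iff hankel_kernel_def)
    then show ?thesis using measurable_compose[OF mult_measurable_dx_over_x \<phi>m] by simp
  qed
  interpret M: sigma_finite_measure dx_over_x by (rule sigma_finite_dx_over_x)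
  have \<kappa>m: "case_prod \<kappa> \<in> borel_measurable (dx_over_x \<Otimes>\<^sub>M dx_over_x)"
  proof -
    have "(\<lambda>p. LINT t|dx_over_x. hankel_kernel \<phi> t (fst p) \<bullet> hankel_kernel \<phi> t (snd p))
      \<in> borel_measurable (dx_over_x \<Otimes>\<^sub>M dx_over_x)"
      by (rule M.borel_measurable_lebesgue_integral) measurable
    then show ?thesis by (simp add: \<kappa>_def case_prod_beta)
  qed
  \<comment> \<open>The last parameter is the square root of the constant in
    \<open>w_form_bound\<close>.\<close>
  interpret T: l2_kernel dx_over_x "hankel_kernel \<phi>" "\<lambda>n. {1<..real n}" "l2_norm dx_over_x \<phi>"
    "sqrt (of_nat DIM('a) * pi) * B"
  proof
    show "hankel_kernel \<phi> x y = hankel_kernel \<phi> y x" for x y by (simp add: hankel_kernel_def mult.commute)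
    show "hankel_kernel \<phi> x \<in> l2 dx_over_x UNIV" "l2_norm dx_over_x (hankel_kernel \<phi> x) \<le> l2_norm dx_over_x \<phi>"
      if "x \<in> space dx_over_x" for x
      using l2_dilation[OF \<phi>l2, of x] that by (simp_all add: hankel_kernel_def[abs_def])
    show "{1<..real n} \<in> sets dx_over_x" for n
      by (auto simp: sets_dx_over_x sets_restrict_space image_iff intro!: exI[of _ "{1<..real n}"])
    show "incseq (\<lambda>n. {1<..real n})" by (auto simp: incseq_def)
    show "(\<Union>n. {1<..real n}) = space dx_over_x" using real_arch_simple by fastforce
    show "emeasure dx_over_x {1<..real n} < \<infinity>" for n by (rule emeasure_dx_over_x_finite)
    fix g :: "real \<Rightarrow> real" and n
    assume g: "g \<in> l2 dx_over_x UNIV" "\<And>x. x \<notin> {1<..real n} \<Longrightarrow> g x = 0"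
      and int: "integrable (dx_over_x \<Otimes>\<^sub>M dx_over_x)
         (\<lambda>(x, y). g x * g y * (LINT t|dx_over_x. hankel_kernel \<phi> t x \<bullet> hankel_kernel \<phi> t y))"
    have "(LINT p|(dx_over_x \<Otimes>\<^sub>M dx_over_x). (case p of (x, y) \<Rightarrow> g x * g y * \<kappa> x y))
      \<le> of_nat DIM('a) * (pi * B\<^sup>2 * (l2_norm dx_over_x g)\<^sup>2)"
      by (rule w_form_bound[OF g \<kappa>m \<kappa>w]) (use int in \<open>simp_all add: \<kappa>_def\<close>)
    then show "(LINT p|(dx_over_x \<Otimes>\<^sub>M dx_over_x). (case p of (x, y) \<Rightarrow> g x * g y *
         (LINT t|dx_over_x. hankel_kernel \<phi> t x \<bullet> hankel_kernel \<phi> t y)))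
      \<le> (sqrt (of_nat DIM('a) * pi) * B * l2_norm dx_over_x g)\<^sup>2"
      by (simp add: \<kappa>_def power_mult_distrib mult.assoc)
  qed (use meas B0 in auto)
  have S: "T.S = (\<lambda>h x. LINT t|dx_over_x. \<phi> (x * t) \<bullet> h t)"
    by (simp add: T.S_def[abs_def] hankel_kernel_def)
  have w_AE: "AE y in dx_over_x. g y * \<kappa> x y = g y *\<^sub>R w x y" if "1 < x" for g x
    using AE_dx_over_x_singleton[of x] AE_space by eventually_elim (use that \<kappa>w in auto)
  have w_op: "integrable dx_over_x (\<lambda>y. g y *\<^sub>R w x y)" "integral_op dx_over_x w g x = T.S (hankel_op \<phi> g) x"
    if g: "g \<in> l2 dx_over_x UNIV" and x: "1 < x" for g x
  proof -
    have xs: "x \<in> space dx_over_x" using x by simp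
    have [measurable]: "g \<in> borel_measurable dx_over_x" using g by (rule l2_measurable)
    have [measurable]: "w x \<in> borel_measurable dx_over_x" using measurable_Pair2[OF w_measurable xs] by simp
    have [measurable]: "\<kappa> x \<in> borel_measurable dx_over_x" using measurable_Pair2[OF \<kappa>m xs] by simp
    have "integrable dx_over_x (\<lambda>y. g y * \<kappa> x y)"
      using T.S_T(2)[OF g xs] by (simp add: \<kappa>_def)
    then show "integrable dx_over_x (\<lambda>y. g y *\<^sub>R w x y)"
      using integrable_cong_AE[OF _ _ w_AE[OF x, of g]] by simp
    have "(LINT y|dx_over_x. g y * \<kappa> x y) = (LINT y|dx_over_x. g y *\<^sub>R w x y)"
      by (rule integral_cong_AE[OF _ _ w_AE[OF x]]) measurable
    then show "integral_op dx_over_x w g x = T.S (hankel_op \<phi> g) x"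
      using T.S_T(1)[OF g xs] by (simp add: integral_op_def \<kappa>_def)
  qed
  have "maps_l2 dx_over_x UNIV w"
    unfolding maps_l2_def
  proof (intro ballI conjI)
    fix g :: "real \<Rightarrow> real" assume g: "g \<in> l2 dx_over_x UNIV"
    show "AE x in dx_over_x. integrable dx_over_x (\<lambda>y. g y *\<^sub>R w x y)"
      by (rule AE_I2) (use w_op(1)[OF g] in simp)
    have S2: "T.S (hankel_op \<phi> g) \<in> l2 dx_over_x UNIV" by (rule T.S_l2[OF T.T_l2[OF g]])
    have "integral_op dx_over_x w g \<in> borel_measurable dx_over_x"
      using l2_measurable[OF S2] by (rule measurable_cong[THEN iffD2, rotated]) (use w_op(2)[OF g] in simp)
    then show "integral_op dx_over_x w g \<in> l2 dx_over_x UNIV"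
      by (rule l2_dominated(1)[OF _ S2]) (use w_op(2)[OF g] in simp)
  qed
  moreover have "\<phi> \<in> l2 dx_over_x K" using \<phi>l2 \<phi>K by (simp add: l2_def)
  moreover have "maps_l2 dx_over_x K (hankel_kernel \<phi>)"
    unfolding maps_l2_def
  proof (intro ballI conjI)
    fix g :: "real \<Rightarrow> real" assume g: "g \<in> l2 dx_over_x UNIV"
    show "AE x in dx_over_x. integrable dx_over_x (\<lambda>y. g y *\<^sub>R hankel_kernel \<phi> x y)"
      by (rule AE_I2) (rule T.T_integrable[OF g])
    have "hankel_op \<phi> g x \<in> K" if "x \<in> space dx_over_x" for x
      by (rule T.T_in_subspace[OF K(1) _ g that]) (simp add: hankel_kernel_def \<phi>K)
    then show "hankel_op \<phi> g \<in> l2 dx_over_x K" using T.T_l2[OF g] by (simp add: l2_def)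
  qed
  moreover have "is_l2_adjoint dx_over_x K (hankel_op \<phi>) T.S"
    unfolding is_l2_adjoint_def using T.S_l2[OF l2_mono] T.adjoint[OF l2_mono] by blast
  moreover have "l2_op_eq dx_over_x (integral_op dx_over_x w) (T.S \<circ> hankel_op \<phi>)"
    unfolding l2_op_eq_def using w_op(2) by (auto intro!: AE_I2)
  ultimately show ?thesis
    using K T.T_continuous unfolding S by blast
qed

end

section \<open>The factorisation theorem\<close>

text \<open>Since \<open>J_mat\<close> squares to minus the identity, the term with \<alpha>
  contributes \<open>- \<alpha> *\<^sub>R v x\<close> to
  \<open>x *\<^sub>R vector_derivative v (at x)\<close>, which cancels the derivative of
  \<open>x powr \<alpha>\<close>.\<close>

lemma powr_scaled_equation:
  fixes \<Omega>\<^sub>1 \<Omega>\<^sub>0 \<Omega>\<^sub>m :: "real^('n::finite + 'n)^('n + 'n)" and v :: "real \<Rightarrow> real^('n + 'n)"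
  assumes x: "0 < x" and d: "v differentiable (at x)"
    and eq: "x *\<^sub>R vector_derivative v (at x) =
      J_mat *v ((x *\<^sub>R \<Omega>\<^sub>1 + \<Omega>\<^sub>0 + \<alpha> *\<^sub>R J_mat + inverse x *\<^sub>R \<Omega>\<^sub>m) *v v x)"
  shows "((\<lambda>x. x powr \<alpha> *\<^sub>R v x) has_vector_derivative
    inverse x *\<^sub>R (J_mat *v ((x *\<^sub>R \<Omega>\<^sub>1 + \<Omega>\<^sub>0 + inverse x *\<^sub>R \<Omega>\<^sub>m) *v (x powr \<alpha> *\<^sub>R v x)))) (at x)"
proof -
  let ?N = "x *\<^sub>R \<Omega>\<^sub>1 + \<Omega>\<^sub>0 + inverse x *\<^sub>R \<Omega>\<^sub>m"
  have JJ: "J_mat *v (J_mat *v p) = - p" for p :: "real^('n + 'n)"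
    by (simp add: J_mat_vector vec_eq_iff split: sum.split)
  have "x *\<^sub>R vector_derivative v (at x) = J_mat *v (?N *v v x + \<alpha> *\<^sub>R (J_mat *v v x))"
    unfolding eq by (simp add: matrix_vector_mult_add_rdistrib scaleR_matrix_vector_assoc algebra_simps)
  also have "\<dots> = J_mat *v (?N *v v x) - \<alpha> *\<^sub>R v x"
    by (simp add: matrix_vector_right_distrib matrix_vector_mult_scaleR JJ)
  finally have "inverse x *\<^sub>R (x *\<^sub>R vector_derivative v (at x)) = inverse x *\<^sub>R (J_mat *v (?N *v v x) - \<alpha> *\<^sub>R v x)"
    by (rule arg_cong)
  then have dv: "vector_derivative v (at x) = inverse x *\<^sub>R (J_mat *v (?N *v v x) - \<alpha> *\<^sub>R v x)"
    using x by simp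
  have p: "((\<lambda>x. x powr \<alpha>) has_real_derivative \<alpha> * x powr (\<alpha> - 1)) (at x)"
    by (rule has_real_derivative_powr[OF x])
  have "((\<lambda>x. x powr \<alpha> *\<^sub>R v x) has_vector_derivative
      x powr \<alpha> *\<^sub>R vector_derivative v (at x) + (\<alpha> * x powr (\<alpha> - 1)) *\<^sub>R v x) (at x)"
    by (rule has_vector_derivative_scaleR[OF p]) (use d in \<open>simp add: vector_derivative_works\<close>)
  moreover have "x powr \<alpha> *\<^sub>R vector_derivative v (at x) + (\<alpha> * x powr (\<alpha> - 1)) *\<^sub>R v x
    = inverse x *\<^sub>R (J_mat *v (?N *v (x powr \<alpha> *\<^sub>R v x)))"
    unfolding dv using x
    by (simp add: matrix_vector_mult_scaleR powr_diff scaleR_diff_right field_simps)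
  ultimately show ?thesis by simp
qed

lemma matrix_vector_norm_bound: "\<exists>k\<ge>0. \<forall>x. norm (A *v x) \<le> k * norm x" for A :: "real^'n^'m"
  using bounded_linear.nonneg_bounded[OF matrix_vector_mul_bounded_linear[of A]]
  by (auto simp: mult.commute)

text \<open>The factor \<open>sqrt x\<close>, once squared, cancels the density
  \<open>1 / x\<close>, so square integrability of \<open>u\<close> for \<open>dx\<close> becomes
  that of \<open>c\<close> for \<open>dx/x\<close>.\<close>

lemma coefficient_l2:
  fixes u :: "real \<Rightarrow> 'a::euclidean_space"
  assumes u: "u \<in> l2 dx_measure UNIV" and cont: "continuous_on {1<..} c"
    and le: "\<And>x. 1 < x \<Longrightarrow> \<bar>c x\<bar> \<le> k * (sqrt x * norm (u x))"
  shows "c \<in> l2 dx_over_x UNIV"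
proof (rule l2_I)
  show m: "c \<in> borel_measurable dx_over_x" by (rule continuous_on_measurable_dx_over_x[OF cont])
  have sq: "(\<lambda>x. (norm (c x))\<^sup>2) \<in> borel_measurable dx_over_x" using m by measurable
  show "integrable dx_over_x (\<lambda>x. (norm (c x))\<^sup>2)"
    unfolding integrable_dx_over_x_iff[OF sq]
  proof (rule Bochner_Integration.integrable_bound)
    have "integrable lborel (\<lambda>x. indicator {1<..} x *\<^sub>R (norm (u x))\<^sup>2)"
      using u by (simp add: l2_def dx_measure_def integrable_restrict_space)
    then show "integrable lborel (\<lambda>x. k\<^sup>2 * (indicator {1<..} x *\<^sub>R (norm (u x))\<^sup>2))" by simp
    have "(\<lambda>x. (1 / x) *\<^sub>R (norm (c x))\<^sup>2) \<in> borel_measurable dx_over_x" using m by measurable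
    then show "(\<lambda>x. indicator {1<..} x *\<^sub>R (1 / x) *\<^sub>R (norm (c x))\<^sup>2) \<in> borel_measurable lborel"
      unfolding measurable_dx_over_x_iff by simp
    show "AE x in lborel. norm (indicator {1<..} x *\<^sub>R (1 / x) *\<^sub>R (norm (c x))\<^sup>2)
        \<le> norm (k\<^sup>2 * (indicator {1<..} x *\<^sub>R (norm (u x))\<^sup>2))"
    proof (rule AE_I2)
      fix x :: real
      show "norm (indicator {1<..} x *\<^sub>R (1 / x) *\<^sub>R (norm (c x))\<^sup>2)
        \<le> norm (k\<^sup>2 * (indicator {1<..} x *\<^sub>R (norm (u x))\<^sup>2))"
      proof (cases "1 < x")
        case True
        have "(norm (c x))\<^sup>2 \<le> (k * (sqrt x * norm (u x)))\<^sup>2"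
          using le[OF True] by (intro power_mono) auto
        also have "\<dots> = x * (k\<^sup>2 * (norm (u x))\<^sup>2)"
          using True by (simp add: power_mult_distrib)
        finally have "(1 / x) * (norm (c x))\<^sup>2 \<le> k\<^sup>2 * (norm (u x))\<^sup>2"
          using True by (simp add: field_simps)
        then show ?thesis using True by simp
      qed simp
    qed
  qed
qed

theorem theorem4p1:
  fixes \<alpha> :: real
    and \<Omega>\<^sub>1 \<Omega>\<^sub>0 \<Omega>\<^sub>m\<^sub>1 :: "real^('n::finite + 'n)^('n + 'n)"
    and v :: "real \<Rightarrow> real^('n + 'n)"
  assumes sym: "transpose \<Omega>\<^sub>1 = \<Omega>\<^sub>1" "transpose \<Omega>\<^sub>0 = \<Omega>\<^sub>0" "transpose \<Omega>\<^sub>m\<^sub>1 = \<Omega>\<^sub>m\<^sub>1"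
    and psd: "pos_semidef \<Omega>\<^sub>1" "pos_semidef (- \<Omega>\<^sub>m\<^sub>1)"
    and ode: "\<And>x. x > 1 \<Longrightarrow> v differentiable (at x) \<and>
        x *\<^sub>R vector_derivative v (at x) =
          J_mat *v ((x *\<^sub>R \<Omega>\<^sub>1 + \<Omega>\<^sub>0 + \<alpha> *\<^sub>R J_mat + inverse x *\<^sub>R \<Omega>\<^sub>m\<^sub>1) *v v x)"
    and bdd: "bounded ((\<lambda>x. x powr \<alpha> *\<^sub>R v x) ` {1<..})"
      "bounded ((\<lambda>x. x powr (\<alpha> - 1) *\<^sub>R v x) ` {1<..})"
    and L2: "(\<lambda>x. x powr \<alpha> *\<^sub>R v x) \<in> l2 dx_measure UNIV"
      "(\<lambda>x. x powr (\<alpha> - 1) *\<^sub>R v x) \<in> l2 dx_measure UNIV"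
  shows "maps_l2 dx_over_x UNIV (W_kernel \<alpha> v) \<and>
    (\<exists>(K :: (real^(('n + 'n) + ('n + 'n))) set) \<phi>.
      subspace K \<and> dim K \<le> rank \<Omega>\<^sub>1 + rank \<Omega>\<^sub>m\<^sub>1 \<and>
      \<phi> \<in> l2 dx_over_x K \<and>
      maps_l2 dx_over_x K (hankel_kernel \<phi>) \<and>
      l2_continuous dx_over_x (hankel_op \<phi>) \<and>
      (\<exists>S. is_l2_adjoint dx_over_x K (hankel_op \<phi>) S \<and>
           l2_op_eq dx_over_x (W_op \<alpha> v) (S \<circ> hankel_op \<phi>))) \<and>
    (rank \<Omega>\<^sub>1 + rank \<Omega>\<^sub>m\<^sub>1 = 1 \<longrightarrow>
      (\<exists>\<psi> :: real \<Rightarrow> real. \<psi> \<in> l2 dx_over_x UNIV \<and>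
        maps_l2 dx_over_x UNIV (hankel_kernel \<psi>) \<and>
        l2_continuous dx_over_x (hankel_op \<psi>) \<and>
        l2_op_eq dx_over_x (W_op \<alpha> v) (hankel_op \<psi> \<circ> hankel_op \<psi>)))"
proof -
  let ?r1 = "rank \<Omega>\<^sub>1" and ?r2 = "rank \<Omega>\<^sub>m\<^sub>1"
  define u where "u = (\<lambda>x. x powr \<alpha> *\<^sub>R v x)"
  define N where "N = (\<lambda>x. x *\<^sub>R \<Omega>\<^sub>1 + \<Omega>\<^sub>0 + inverse x *\<^sub>R \<Omega>\<^sub>m\<^sub>1)"
  define u' where "u' = (\<lambda>x. inverse x *\<^sub>R (J_mat *v (N x *v u x)))"
  have rank_minus: "rank (- \<Omega>\<^sub>m\<^sub>1) = ?r2"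
  proof -
    have "range ((*v) (- \<Omega>\<^sub>m\<^sub>1)) = range ((*v) \<Omega>\<^sub>m\<^sub>1)"
    proof safe
      fix x
      have "(- \<Omega>\<^sub>m\<^sub>1) *v x = \<Omega>\<^sub>m\<^sub>1 *v (- x)" and "\<Omega>\<^sub>m\<^sub>1 *v x = (- \<Omega>\<^sub>m\<^sub>1) *v (- x)"
        by (simp_all add: vec_eq_iff matrix_vector_mult_def sum_negf)
      then show "(- \<Omega>\<^sub>m\<^sub>1) *v x \<in> range ((*v) \<Omega>\<^sub>m\<^sub>1)"
        and "\<Omega>\<^sub>m\<^sub>1 *v x \<in> range ((*v) (- \<Omega>\<^sub>m\<^sub>1))"
        by (simp_all only: rangeI)
    qed
    then show ?thesis by (simp add: rank_dim_range)
  qed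
  obtain b1 where b1: "(\<Omega>\<^sub>1 *v x) \<bullet> y = (\<Sum>i<?r1. (b1 i \<bullet> x) * (b1 i \<bullet> y))" for x y
    using psd_sum_of_squares[OF sym(1) psd(1)] by blast
  have tr: "transpose (- \<Omega>\<^sub>m\<^sub>1) = - \<Omega>\<^sub>m\<^sub>1" using sym(3) by (simp add: transpose_def vec_eq_iff)
  obtain b2 where b2: "((- \<Omega>\<^sub>m\<^sub>1) *v x) \<bullet> y = (\<Sum>i<?r2. (b2 i \<bullet> x) * (b2 i \<bullet> y))" for x y
    using psd_sum_of_squares[OF tr psd(2)] unfolding rank_minus by blast
  \<comment> \<open>The weights are dictated by \<open>key\<close>: the squares from
    \<open>\<Omega>\<^sub>1\<close> come with the factor \<open>sqrt (x * y)\<close>, those from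
    \<open>- \<Omega>\<^sub>m\<^sub>1\<close> with its inverse. The second family is placed after
    the first by shifting the index by \<open>?r1\<close>.\<close>
  define c where "c = (\<lambda>i x. if i < ?r1 then sqrt x * (b1 i \<bullet> u x) else (b2 (i - ?r1) \<bullet> u x) / sqrt x)"
  obtain B where B: "norm (u x) \<le> B" if "1 < x" for x
    using bdd(1) unfolding bounded_iff u_def by auto
  have deriv: "(u has_vector_derivative u' x) (at x)" if "1 < x" for x
    using powr_scaled_equation[of x v] ode[OF that] that unfolding u_def u'_def N_def by simp
  have cont: "continuous_on {1<..} u"
    using deriv by (intro continuous_at_imp_continuous_on ballI) (auto intro: has_vector_derivative_continuous)
  obtain k1 where k1: "0 \<le> k1" "norm (\<Omega>\<^sub>1 *v x) \<le> k1 * norm x" for x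
    using matrix_vector_norm_bound[of \<Omega>\<^sub>1] by blast
  obtain k0 where k0: "0 \<le> k0" "norm (\<Omega>\<^sub>0 *v x) \<le> k0 * norm x" for x
    using matrix_vector_norm_bound[of \<Omega>\<^sub>0] by blast
  obtain km where km: "0 \<le> km" "norm (\<Omega>\<^sub>m\<^sub>1 *v x) \<le> km * norm x" for x
    using matrix_vector_norm_bound[of \<Omega>\<^sub>m\<^sub>1] by blast
  note k = k1 k0 km
  have Jn: "norm (J_mat *v p) = norm p" for p :: "real^('n + 'n)"
    by (simp add: norm_eq_sqrt_inner J_mat_inner(1))
  \<comment> \<open>The coefficient matrix grows at most like \<open>x\<close> for
    \<open>x > 1\<close>, and the equation divides it by \<open>x\<close>.\<close>
  have u'_bound: "norm (u' x) \<le> (k1 + k0 + km) * B" if x: "1 < x" for x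
  proof -
    have Nx: "N x *v u x = x *\<^sub>R (\<Omega>\<^sub>1 *v u x) + \<Omega>\<^sub>0 *v u x + inverse x *\<^sub>R (\<Omega>\<^sub>m\<^sub>1 *v u x)"
      by (simp add: N_def matrix_vector_mult_add_rdistrib scaleR_matrix_vector_assoc)
    have ix: "inverse x \<le> x" using x le_imp_inverse_le[of 1 x] by simp
    have "norm (N x *v u x) \<le> norm (x *\<^sub>R (\<Omega>\<^sub>1 *v u x)) + norm (\<Omega>\<^sub>0 *v u x) + norm (inverse x *\<^sub>R (\<Omega>\<^sub>m\<^sub>1 *v u x))"
      unfolding Nx by (rule order_trans[OF norm_triangle_ineq add_right_mono[OF norm_triangle_ineq]])
    also have "\<dots> \<le> x * (k1 * norm (u x)) + x * (k0 * norm (u x)) + x * (km * norm (u x))"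
    proof (intro add_mono)
      show "norm (x *\<^sub>R (\<Omega>\<^sub>1 *v u x)) \<le> x * (k1 * norm (u x))"
        using x k(2) by (simp add: mult_left_mono)
      show "norm (\<Omega>\<^sub>0 *v u x) \<le> x * (k0 * norm (u x))"
        using x k(3) k(4)[of "u x"] mult_right_mono[of 1 x "k0 * norm (u x)"] by simp
      show "norm (inverse x *\<^sub>R (\<Omega>\<^sub>m\<^sub>1 *v u x)) \<le> x * (km * norm (u x))"
        using x ix k(5,6) by (simp add: mult_mono)
    qed
    also have "\<dots> = x * ((k1 + k0 + km) * norm (u x))" by (simp add: algebra_simps)
    also have "\<dots> \<le> x * ((k1 + k0 + km) * B)"
      using x k(1,3,5) B[OF x] by (intro mult_left_mono) auto
    finally have *: "norm (N x *v u x) \<le> x * ((k1 + k0 + km) * B)" .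
    have "norm (u' x) = inverse x * norm (N x *v u x)" using x by (simp add: u'_def Jn)
    also have "\<dots> \<le> inverse x * (x * ((k1 + k0 + km) * B))"
      using x by (intro mult_left_mono *) simp
    also have "\<dots> = (k1 + k0 + km) * B" using x by simp
    finally show ?thesis .
  qed
  have c_cont: "continuous_on {1<..} (c i)" for i
    unfolding c_def by (cases "i < ?r1") (auto intro!: continuous_intros cont)
  have c_l2: "c i \<in> l2 dx_over_x UNIV" for i
  proof (cases "i < ?r1")
    case True
    show ?thesis
    proof (rule coefficient_l2[OF L2(1)[folded u_def] c_cont])
      fix x :: real assume x: "1 < x"
      have "sqrt x * \<bar>b1 i \<bullet> u x\<bar> \<le> sqrt x * (norm (b1 i) * norm (u x))"
        using x by (intro mult_left_mono Cauchy_Schwarz_ineq2) simp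
      then show "\<bar>c i x\<bar> \<le> norm (b1 i) * (sqrt x * norm (u x))"
        using True x by (simp add: c_def abs_mult ac_simps)
    qed
  next
    case False
    let ?b = "b2 (i - ?r1)"
    show ?thesis
    proof (rule coefficient_l2[OF L2(1)[folded u_def] c_cont])
      fix x :: real assume x: "1 < x"
      have s: "1 / sqrt x \<le> sqrt x" using x by (simp add: divide_le_eq)
      have "\<bar>?b \<bullet> u x\<bar> * (1 / sqrt x) \<le> (norm ?b * norm (u x)) * sqrt x"
        using x s by (intro mult_mono Cauchy_Schwarz_ineq2) auto
      then show "\<bar>c i x\<bar> \<le> norm ?b * (sqrt x * norm (u x))"
        using False x by (simp add: c_def abs_divide ac_simps)
    qed
  qed
  have key: "sqrt (x * y) * ((J_mat *v (x *\<^sub>R u' x)) \<bullet> u y + (J_mat *v u x) \<bullet> (y *\<^sub>R u' y))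
      = (y - x) * (\<Sum>i<?r1 + ?r2. c i x * c i y)" if x: "1 < x" and y: "1 < y" for x y
  proof -
    let ?a = "(\<Omega>\<^sub>1 *v u x) \<bullet> u y" and ?m = "((- \<Omega>\<^sub>m\<^sub>1) *v u x) \<bullet> u y" and ?s = "sqrt (x * y)"
    have xu: "z *\<^sub>R u' z = J_mat *v (N z *v u z)" if "1 < z" for z using that by (simp add: u'_def)
    have "transpose (N x) = N x" for x
      using sym by (simp add: N_def transpose_def vec_eq_iff)
    note Nsym = inner_matrix_symmetric[OF this]
    have JJ: "(J_mat *v (J_mat *v p)) \<bullet> q = - (p \<bullet> q)" for p q :: "real^('n + 'n)"
      by (simp add: J_mat_inner(2)[of "J_mat *v p"] J_mat_inner(1))
    have Nin: "(N z *v p) \<bullet> q = z * ((\<Omega>\<^sub>1 *v p) \<bullet> q) + (\<Omega>\<^sub>0 *v p) \<bullet> q - inverse z * (((- \<Omega>\<^sub>m\<^sub>1) *v p) \<bullet> q)" for z p q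
    proof -
      have "(- \<Omega>\<^sub>m\<^sub>1) *v p = - (\<Omega>\<^sub>m\<^sub>1 *v p)" by (simp add: vec_eq_iff matrix_vector_mult_def sum_negf)
      then show ?thesis
        by (simp add: N_def matrix_vector_mult_add_rdistrib scaleR_matrix_vector_assoc[symmetric] inner_add_left)
    qed
    \<comment> \<open>Inserting the equation, the first term gets a minus sign from the square of
      \<open>J_mat\<close>, the second loses both copies of \<open>J_mat\<close> by orthogonality,
      and the symmetry of \<open>N y\<close> moves it onto \<open>u x\<close>.\<close>
    have "(J_mat *v (x *\<^sub>R u' x)) \<bullet> u y + (J_mat *v u x) \<bullet> (y *\<^sub>R u' y) = (N y *v u x) \<bullet> u y - (N x *v u x) \<bullet> u y"
      unfolding xu[OF x] xu[OF y] JJ J_mat_inner(1) by (simp add: Nsym)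
    \<comment> \<open>The constant matrix \<open>\<Omega>\<^sub>0\<close> cancels in the
      difference.\<close>
    also have "\<dots> = (y - x) * ?a + (inverse x - inverse y) * ?m"
      unfolding Nin by (simp add: algebra_simps)
    also have "inverse x - inverse y = (y - x) / (x * y)" using x y by (simp add: field_simps)
    finally have E: "(J_mat *v (x *\<^sub>R u' x)) \<bullet> u y + (J_mat *v u x) \<bullet> (y *\<^sub>R u' y)
      = (y - x) * ?a + ((y - x) / (x * y)) * ?m" .
    have gen: "s * (d * a + (d / p) * m) = d * (s * a + (s / p) * m)" for s d a p m :: real
      by (simp add: algebra_simps)
    have 1: "?s * ((J_mat *v (x *\<^sub>R u' x)) \<bullet> u y + (J_mat *v u x) \<bullet> (y *\<^sub>R u' y))
      = (y - x) * (?s * ?a + (?s / (x * y)) * ?m)"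
      unfolding E by (rule gen)
    have s: "?s / (x * y) = 1 / ?s"
      using x y by (simp add: field_simps)
    have split: "(\<Sum>i<m + n. f i) = (\<Sum>i<m. f i) + (\<Sum>i<n. f (m + i))" for f :: "nat \<Rightarrow> real" and m n
      by (induction n) (simp_all add: add.assoc)
    have "(\<Sum>i<?r1 + ?r2. c i x * c i y) = (\<Sum>i<?r1. c i x * c i y) + (\<Sum>i<?r2. c (?r1 + i) x * c (?r1 + i) y)"
      by (rule split)
    also have "(\<Sum>i<?r1. c i x * c i y) = ?s * ?a"
      unfolding b1 sum_distrib_left by (intro sum.cong) (auto simp: c_def real_sqrt_mult)
    also have "(\<Sum>i<?r2. c (?r1 + i) x * c (?r1 + i) y) = (1 / ?s) * ?m"
      unfolding b2 sum_distrib_left by (intro sum.cong) (auto simp: c_def real_sqrt_mult)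
    finally show ?thesis unfolding 1 s by simp
  qed
  have "hankel_system u u' ((*v) J_mat) c (?r1 + ?r2) B ((k1 + k0 + km) * B)"
  proof (rule hankel_system.intro)
    show "(J_mat *v p) \<bullet> p = 0" for p :: "real^('n + 'n)"
      using J_mat_inner(2)[of p p] by (simp add: inner_commute)
    show "u \<in> l2 dx_measure UNIV" using L2(1) by (simp add: u_def)
  qed (fact deriv Jn B u'_bound c_cont c_l2 key matrix_vector_mul_linear)+
  then interpret hankel_system u u' "(*v) J_mat" c "?r1 + ?r2" B "(k1 + k0 + km) * B" .

  \<comment> \<open>Transfer from \<open>w\<close> to \<open>W_kernel\<close>\<close>
  have wW: "W_kernel \<alpha> v x y = w x y" if "1 < x" "1 < y" for x y
  proof -
    have "(x * y) powr ((2 * \<alpha> + 1) / 2) = (x * y) powr (\<alpha> + 1 / 2)" by (simp add: field_simps)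
    also have "\<dots> = x powr \<alpha> * y powr \<alpha> * sqrt (x * y)"
      using that by (simp add: powr_add powr_half_sqrt powr_mult real_sqrt_mult)
    finally show ?thesis
      unfolding W_kernel_def w_def by (simp add: u_def matrix_vector_mult_scaleR)
  qed
  have op_eq: "W_op \<alpha> v g x = integral_op dx_over_x w g x" if "x \<in> space dx_over_x" for g x
    unfolding integral_op_def using that by (intro Bochner_Integration.integral_cong) (simp_all add: wW)
  have W_maps: "maps_l2 dx_over_x UNIV (W_kernel \<alpha> v)" if "maps_l2 dx_over_x UNIV w"
    unfolding maps_l2_def
  proof (intro ballI conjI)
    fix g :: "real \<Rightarrow> real" assume g: "g \<in> l2 dx_over_x UNIV"
    have 1: "AE x in dx_over_x. integrable dx_over_x (\<lambda>y. g y *\<^sub>R w x y)"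
      and 2: "integral_op dx_over_x w g \<in> l2 dx_over_x UNIV"
      using that g unfolding maps_l2_def by blast+
    show "AE x in dx_over_x. integrable dx_over_x (\<lambda>y. g y *\<^sub>R W_kernel \<alpha> v x y)"
      using 1 AE_space
    proof eventually_elim
      fix x assume "integrable dx_over_x (\<lambda>y. g y *\<^sub>R w x y)" "x \<in> space dx_over_x"
      then show "integrable dx_over_x (\<lambda>y. g y *\<^sub>R W_kernel \<alpha> v x y)"
        by (subst Bochner_Integration.integrable_cong[OF refl, of _ _ "\<lambda>y. g y *\<^sub>R w x y"]) (simp_all add: wW)
    qed
    have "W_op \<alpha> v g \<in> borel_measurable dx_over_x"
      using l2_measurable[OF 2] by (rule measurable_cong[THEN iffD2, rotated]) (rule op_eq)
    then show "W_op \<alpha> v g \<in> l2 dx_over_x UNIV"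
      by (rule l2_dominated(1)[OF _ 2]) (simp add: op_eq)
  qed
  have W_eq: "l2_op_eq dx_over_x (W_op \<alpha> v) Q" if "l2_op_eq dx_over_x (integral_op dx_over_x w) Q" for Q
    unfolding l2_op_eq_def
  proof
    fix g :: "real \<Rightarrow> real" assume "g \<in> l2 dx_over_x UNIV"
    then have "AE x in dx_over_x. integral_op dx_over_x w g x = Q g x"
      using that unfolding l2_op_eq_def by blast
    then show "AE x in dx_over_x. W_op \<alpha> v g x = Q g x"
      using AE_space by eventually_elim (simp add: op_eq)
  qed
  \<comment> \<open>Each rank is at most the size of the matrices, so the sum of the two ranks fits
    into a space of twice that dimension.\<close>
  have card_sum: "CARD('n + 'n) + CARD('n + 'n) = CARD(('n + 'n) + ('n + 'n))"
    using card_Plus[of "UNIV :: ('n + 'n) set" "UNIV :: ('n + 'n) set"] by (simp add: UNIV_Plus_UNIV)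
  have "?r1 + ?r2 \<le> DIM(real^(('n + 'n) + ('n + 'n)))"
    using rank_bound[of \<Omega>\<^sub>1] rank_bound[of \<Omega>\<^sub>m\<^sub>1] card_sum by simp
  note fac = factorisation[OF this]
  have scalar: "\<exists>\<psi> :: real \<Rightarrow> real. \<psi> \<in> l2 dx_over_x UNIV \<and>
        maps_l2 dx_over_x UNIV (hankel_kernel \<psi>) \<and>
        l2_continuous dx_over_x (hankel_op \<psi>) \<and>
        l2_op_eq dx_over_x (W_op \<alpha> v) (hankel_op \<psi> \<circ> hankel_op \<psi>)" if "?r1 + ?r2 = 1"
  proof -
    have "?r1 + ?r2 \<le> DIM(real)" using that by simp
    from conjunct2[OF factorisation[OF this]] obtain K and \<psi> :: "real \<Rightarrow> real" where
      \<psi>: "\<psi> \<in> l2 dx_over_x K" "maps_l2 dx_over_x K (hankel_kernel \<psi>)" "l2_continuous dx_over_x (hankel_op \<psi>)"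
      "l2_op_eq dx_over_x (integral_op dx_over_x w)
        ((\<lambda>h x. LINT t|dx_over_x. \<psi> (x * t) \<bullet> h t) \<circ> hankel_op \<psi>)"
      by (elim exE conjE) (rule that; assumption)
    \<comment> \<open>For a scalar symbol the inner product is multiplication, so the adjoint has
      the same kernel \<open>\<psi> (x * t)\<close> and the Hankel operator is self-adjoint; the
      factorisation becomes a square.\<close>
    have "(\<lambda>h x. LINT t|dx_over_x. \<psi> (x * t) \<bullet> h t) = hankel_op \<psi>"
      by (simp add: fun_eq_iff integral_op_def hankel_kernel_def mult.commute)
    then have "l2_op_eq dx_over_x (W_op \<alpha> v) (hankel_op \<psi> \<circ> hankel_op \<psi>)"
      using W_eq[OF \<psi>(4)] by simp
    moreover have "maps_l2 dx_over_x UNIV (hankel_kernel \<psi>)"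
      unfolding maps_l2_def
    proof (intro ballI conjI)
      fix g :: "real \<Rightarrow> real" assume "g \<in> l2 dx_over_x UNIV"
      from bspec[OF \<psi>(2)[unfolded maps_l2_def] this]
      show "AE x in dx_over_x. integrable dx_over_x (\<lambda>y. g y *\<^sub>R hankel_kernel \<psi> x y)"
        and "hankel_op \<psi> g \<in> l2 dx_over_x UNIV"
        by (auto intro: l2_mono)
    qed
    ultimately show ?thesis using \<psi>(3) l2_mono[OF \<psi>(1)] by (intro exI[of _ \<psi>] conjI)
  qed
  obtain K :: "(real^(('n + 'n) + ('n + 'n))) set" and \<phi> where
    "subspace K" "dim K \<le> ?r1 + ?r2" "\<phi> \<in> l2 dx_over_x K" "maps_l2 dx_over_x K (hankel_kernel \<phi>)"
    "l2_continuous dx_over_x (hankel_op \<phi>)"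
    and adj: "is_l2_adjoint dx_over_x K (hankel_op \<phi>) (\<lambda>h x. LINT t|dx_over_x. \<phi> (x * t) \<bullet> h t)"
    and eq: "l2_op_eq dx_over_x (integral_op dx_over_x w)
      ((\<lambda>h x. LINT t|dx_over_x. \<phi> (x * t) \<bullet> h t) \<circ> hankel_op \<phi>)"
    using conjunct2[OF fac] by (elim exE conjE) (rule that; assumption)
  note \<phi> = this
  show ?thesis
  proof (intro conjI impI)
    show "maps_l2 dx_over_x UNIV (W_kernel \<alpha> v)" by (rule W_maps[OF conjunct1[OF fac]])
    show "\<exists>(K :: (real^(('n + 'n) + ('n + 'n))) set) \<phi>.
      subspace K \<and> dim K \<le> ?r1 + ?r2 \<and> \<phi> \<in> l2 dx_over_x K \<and>
      maps_l2 dx_over_x K (hankel_kernel \<phi>) \<and> l2_continuous dx_over_x (hankel_op \<phi>) \<and>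
      (\<exists>S. is_l2_adjoint dx_over_x K (hankel_op \<phi>) S \<and>
           l2_op_eq dx_over_x (W_op \<alpha> v) (S \<circ> hankel_op \<phi>))"
      by (intro exI conjI) (rule \<phi> W_eq)+
  qed (rule scalar)
qed

end
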